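(* Let $t \geq 1$ be an integer and $p \in (0,1)$. (1) If $p < 1/2$ then $w_\infty(t,p) = w(t,p)$. Furthermore, if $\mathcal{F}$ is a $t$-intersecting family on infinitely many points satisfying $\mu_p(\mathcal{F}) = w_\infty(t,p)$ then $\mathcal{F}$ is essentially finitely determined. (2) If $p = 1/2$ then $w_\infty(t,p) = 1/2$. Furthermore, if $t>1$ then no $t$-intersecting family on infinitely many points has $\mu_{1/2}$-measure $1/2$. (3) If $p > 1/2$ then $w_\infty(t,p) = 1$. In fact, there is a family $\mathcal{F}\subseteq 2^{\mathbb{N}}$, measurable for every $\mu_p$, in which any two sets have infinitely many common elements and which satisfies $\mu_p(\mathcal{F}) = 1$ for all $p \in(1/2,1)$.
   Context: For $p\in(0,1)$, $\mu_p$ on $2^{\mathbb{N}}$ is the infinite product measure in which each element of $\mathbb{N}$ is included independently with probability $p$ (extending the finite measures $\mu_p(A)=p^{|A|}(1-p)^{n-|A|}$ on subsets of $[n]$). A family on infinitely many points is a $\mu_p$-measurable subset $\mathcal{F}\subseteq 2^{\mathbb{N}}$; it is $t$-intersecting if any $A,B\in\mathcal{F}$ have at least $t$ common elements. $\mathcal{F}$ is finitely determined if $\mathcal{F}=\{A : A\cap[n]\in\mathcal{G}\}$ for some $n$ and some family $\mathcal{G}$ of subsets of $[n]$; it is essentially finitely determined if it differs from a finitely determined family by a $\mu_p$-null set. $w_\infty(t,p)$ is the supremum of $\mu_p(\mathcal{F})$ over all $t$-intersecting families on infinitely many points. For finite $n\ge t$, $w(n,t,p)$ is the maximum $\mu_p$-measure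 of a $t$-intersecting family of subsets of $[n]$, and $w(t,p)=\sup_n w(n,t,p)$. *)

theory Defs
  imports "HOL-Probability.Probability" "HOL-Analysis.Embed_Measure"
begin

text \<open>The points are the natural numbers starting from \<open>0\<close>, so \<open>[n]\<close> is \<^term>\<open>{..<n::nat}\<close>.\<close>

definition mu_fin :: "nat \<Rightarrow> real \<Rightarrow> nat set set \<Rightarrow> real" where
  "mu_fin n p \<G> = (\<Sum>A\<in>\<G>. p ^ card A * (1 - p) ^ (n - card A))"

text \<open>\<^const>\<open>Collect\<close> carries the product measure from indicator functions to subsets of the
  naturals.  Because of the completion, \<open>sets (mu p)\<close> consists of the \<open>\<mu>\<^sub>p\<close>-measurable families.\<close>

definition mu :: "real \<Rightarrow> nat set measure" where
  "mu p = completion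
     (embed_measure (PiM UNIV (\<lambda>i::nat. measure_pmf (bernoulli_pmf p))) Collect)"

text \<open>The sets may be infinite, where \<^const>\<open>card\<close> is \<open>0\<close>; \<open>A\<close> and \<open>B\<close> may coincide.\<close>

definition t_intersecting :: "nat \<Rightarrow> nat set set \<Rightarrow> bool" where
  "t_intersecting t \<F> \<longleftrightarrow>
     (\<forall>A\<in>\<F>. \<forall>B\<in>\<F>. infinite (A \<inter> B) \<or> t \<le> card (A \<inter> B))"

definition finitely_determined :: "nat set set \<Rightarrow> bool" where
  "finitely_determined \<F> \<longleftrightarrow>
     (\<exists>n. \<exists>\<G>\<subseteq>Pow {..<n}. \<F> = {A. A \<inter> {..<n} \<in> \<G>})"

definition essentially_finitely_determined :: "real \<Rightarrow> nat set set \<Rightarrow> bool" where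
  "essentially_finitely_determined p \<F> \<longleftrightarrow>
     (\<exists>\<D>. finitely_determined \<D> \<and> sym_diff \<F> \<D> \<in> null_sets (mu p))"

definition w_fin :: "nat \<Rightarrow> nat \<Rightarrow> real \<Rightarrow> real" where
  "w_fin n t p = Max {mu_fin n p \<G> |\<G>. \<G> \<subseteq> Pow {..<n} \<and> t_intersecting t \<G>}"

definition w :: "nat \<Rightarrow> real \<Rightarrow> real" where
  "w t p = (SUP n\<in>{t..}. w_fin n t p)"

definition w_inf :: "nat \<Rightarrow> real \<Rightarrow> real" where
  "w_inf t p = Sup {measure (mu p) \<F> |\<F>. \<F> \<in> sets (mu p) \<and> t_intersecting t \<F>}"

end

(* For a family F and A <= [n] let f(A) be the conditional measure of F given that the trace on [n]
   is A.  If p <= 1/2 and |A Int B| < t, then f(A) + f(B) <= 1, because two p-random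
   sets can be coupled so as to be disjoint.  Hence {f > 1/2} is t-intersecting, and it
   tends to F in measure; this gives w_inf = w.

   Now let p < 1/2 and let F attain w_inf.  Shifting F towards an initial segment [n] whose length
   depends only on t and p makes F independent of any prescribed finite set of coordinates outside
   [n]: otherwise an averaging argument produces a t-intersecting family of larger measure.  The
   shifted family is therefore close to a family G determined by [n].  An isoperimetric inequality
   for cross-intersecting families, f(A) <= (1 - f(B)) powr g with g > 1, shows that it equals G up
   to a null set.  Shifting does not change the influence of a coordinate outside the shifted range,
   so F itself has only finitely many relevant coordinates.

   For p = 1/2 and t > 1 the family F and its image under flipping one coordinate together are
   still intersecting, so F is invariant under all flips and has measure 0 or 1.  For p > 1/2 any two
   sets with at least n/2 + sqrt (n/2) elements in [n] for all large n = 2 k^2 meet infinitely often. *)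
theory Submission
  imports Defs
begin

section \<open>The uncompleted measure\<close>

text \<open>The constants have to be fixed in the right order. The length \<open>n\<close> comes
  from \<open>t\<close> and \<open>p\<close>, and a tolerance \<open>\<eta>\<close> from
  \<open>n\<close> and the extremal measure; only then is the family approximated within
  \<open>\<eta>\<close> by a family on some first \<open>m\<close> coordinates. So only the finitely
  many coordinates from \<open>n\<close> up to \<open>m\<close> have to be shifted away, and no
  limit of shifts is taken. Hence the shifted family is within \<open>\<eta>\<close> of one
  determined by \<open>n\<close> coordinates, where closeness already forces equality up to a null
  set. The exponent g is ln p / ln (1 - p), the solution of (1 - p) powr g = p; it exceeds 1 exactly
  when p < 1/2. The family is made closed under insertions beforehand because its influences are
  then differences of measures of two sections, and shifts preserve both measures.\<close>

definition cube :: "real \<Rightarrow> nat set measure" where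
  "cube p = embed_measure (PiM UNIV (\<lambda>i::nat. measure_pmf (bernoulli_pmf p))) Collect"

text \<open>The analysis takes place in the uncompleted \<open>cube p\<close>, where measurability
  can be checked on generators; \<open>mu_core\<close> reduces completed families to it at the
  end.\<close>

lemma mu_eq_completion: "mu p = completion (cube p)"
  by (simp add: mu_def cube_def)

lemma space_cube [simp]: "space (cube p) = UNIV"
proof -
  have "surj (Collect :: (nat \<Rightarrow> bool) \<Rightarrow> nat set)"
    by (rule surjI[of _ "\<lambda>A i. i \<in> A"]) simp
  then show ?thesis
    by (simp add: cube_def space_embed_measure space_PiM PiE_UNIV_domain)
qed

lemma inj_Collect: "inj Collect"
  by (rule injI) (simp add: set_eq_iff fun_eq_iff)

lemma measurable_cubeI:
  assumes "\<And>i. {x\<in>space M. i \<in> g x} \<in> sets M"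
  shows "g \<in> measurable M (cube p)"
proof -
  have "(\<lambda>x i. i \<in> g x) \<in> measurable M (PiM UNIV (\<lambda>i::nat. measure_pmf (bernoulli_pmf p)))"
  proof (rule measurable_PiM_single')
    fix i :: nat
    have "Measurable.pred M (\<lambda>x. i \<in> g x)"
      using assms[of i] by (simp add: pred_def)
    then show "(\<lambda>x. i \<in> g x) \<in> M \<rightarrow>\<^sub>M measure_pmf (bernoulli_pmf p)"
      by (simp add: measurable_def)
  qed (simp add: PiE_def extensional_def)
  moreover have "Collect \<in> measurable (PiM UNIV (\<lambda>i::nat. measure_pmf (bernoulli_pmf p))) (cube p)"
    unfolding cube_def by (rule measurable_embed_measure2[OF inj_Collect])
  ultimately have "(\<lambda>x. Collect (\<lambda>i. i \<in> g x)) \<in> measurable M (cube p)"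
    by (rule measurable_compose)
  then show ?thesis by simp
qed

lemma sets_cube_member [measurable]: "{A. i \<in> A} \<in> sets (cube p)"
proof -
  let ?P = "PiM UNIV (\<lambda>i::nat. measure_pmf (bernoulli_pmf p))"
  have 1: "{f. f i} \<in> sets ?P"
    using sets_Collect_single[of i UNIV "{True}" "\<lambda>i. measure_pmf (bernoulli_pmf p)"]
    by (simp add: space_PiM PiE_UNIV_domain)
  have "{A. i \<in> A} = Collect ` {f. f i}"
  proof (intro equalityI subsetI)
    fix A assume "A \<in> {A. i \<in> A}"
    then show "A \<in> Collect ` {f. f i}"
      by (intro image_eqI[of _ _ "\<lambda>j. j \<in> A"]) auto
  qed auto
  then show ?thesis using 1
    by (auto simp: cube_def sets_embed_measure inj_Collect)
qed

lemma subset_Pow_UNIV: "A \<subseteq> Pow UNIV"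
  by simp

lemma sets_cube_superset: "finite I \<Longrightarrow> {A. I \<subseteq> A} \<in> sets (cube p)"
proof (induction I rule: finite_induct)
  case empty
  then show ?case using sets.top[of "cube p"] by simp
next
  case (insert i I)
  then have "{A. i \<in> A} \<inter> {A. I \<subseteq> A} \<in> sets (cube p)" by (intro sets.Int) auto
  moreover have "{A. i \<in> A} \<inter> {A. I \<subseteq> A} = {A. insert i I \<subseteq> A}" by auto
  ultimately show ?case by simp
qed

text \<open>These cylinders are closed under intersection and have measure
  \<open>p ^ card I\<close>, so uniqueness of measures and induction over the sigma-algebra need
  only this one family of sets.\<close>

lemma sets_cube: "sets (cube p) = sigma_sets UNIV {{A. I \<subseteq> A} |I. finite I}"
proof
  let ?S = "sigma UNIV {{A. I \<subseteq> A} |I::nat set. finite I}"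
  have "(\<lambda>A. A) \<in> measurable ?S (cube p)"
  proof (rule measurable_cubeI)
    fix i
    have "{A. {i} \<subseteq> A} \<in> sets ?S" by (rule in_measure_of) blast+
    then show "{x \<in> space ?S. i \<in> x} \<in> sets ?S" by simp
  qed
  then have "A \<in> sets ?S" if "A \<in> sets (cube p)" for A
    using measurable_sets[OF _ that, of "\<lambda>A. A" ?S] by simp
  then show "sets (cube p) \<subseteq> sigma_sets UNIV {{A. I \<subseteq> A} |I. finite I}" by auto
  show "sigma_sets UNIV {{A. I \<subseteq> A} |I. finite I} \<subseteq> sets (cube p)"
    using sets.sigma_sets_subset[of "{{A. I \<subseteq> A} |I. finite I}" "cube p"]
    using sets_cube_superset[of _ p] by auto
qed

lemma prob_space_cube: "prob_space (cube p)"
proof -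
  have "prob_space (PiM UNIV (\<lambda>i::nat. measure_pmf (bernoulli_pmf p)))"
    by (intro prob_space_PiM measure_pmf.prob_space_axioms)
  then show ?thesis
    unfolding cube_def by (subst embed_measure_eq_distr[OF inj_Collect])
      (intro prob_space.prob_space_distr measurable_embed_measure2 inj_Collect)
qed

lemma Int_stable_superset: "Int_stable {{A. I \<subseteq> A} |I. finite I}"
proof (rule Int_stableI, clarsimp)
  fix I J :: "'a set" assume "finite I" "finite J"
  then show "\<exists>K. {A. I \<subseteq> A} \<inter> {A. J \<subseteq> A} = {A. K \<subseteq> A} \<and> finite K"
    by (intro exI[of _ "I \<union> J"]) auto
qed

lemma emeasure_cube_superset:
  assumes "finite I" "0 \<le> p" "p \<le> 1"
  shows "emeasure (cube p) {A. I \<subseteq> A} = ennreal (p ^ card I)"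
proof -
  let ?P = "PiM UNIV (\<lambda>i::nat. measure_pmf (bernoulli_pmf p))"
  interpret product_prob_space "\<lambda>i::nat. measure_pmf (bernoulli_pmf p)" UNIV
    by unfold_locales
  have "emeasure (cube p) {A. I \<subseteq> A} = emeasure ?P {f \<in> space ?P. \<forall>i\<in>I. f i \<in> {True}}"
    using sets_cube_superset[OF assms(1), of p] unfolding cube_def
    by (subst emeasure_embed_measure[OF inj_Collect])
       (auto intro!: arg_cong[where f = "emeasure ?P"] simp: space_PiM)
  also have "\<dots> = (\<Prod>i\<in>I. emeasure (measure_pmf (bernoulli_pmf p)) {True})"
    by (rule emeasure_PiM_Collect) (use assms in auto)
  also have "\<dots> = ennreal (p ^ card I)"
    using assms by (simp add: emeasure_pmf_single ennreal_power)
  finally show ?thesis .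
qed

lemma measure_cube_superset:
  assumes "finite I" "0 \<le> p" "p \<le> 1"
  shows "measure (cube p) {A. I \<subseteq> A} = p ^ card I"
  using assms(2) unfolding measure_def emeasure_cube_superset[OF assms]
  by (intro enn2real_ennreal) simp

lemma cube_eqI:
  assumes "sets M = sets (cube p)" "0 \<le> p" "p \<le> 1"
    and "\<And>I. finite I \<Longrightarrow> emeasure M {A. I \<subseteq> A} = ennreal (p ^ card I)"
  shows "M = cube p"
proof (rule measure_eqI_generator_eq[OF Int_stable_superset, where \<Omega> = UNIV and A = "\<lambda>_. UNIV"])
  show "emeasure M X = emeasure (cube p) X" if "X \<in> {{A. I \<subseteq> A} |I. finite I}" for X
    using that assms emeasure_cube_superset by auto
  show "range (\<lambda>_. UNIV) \<subseteq> {{A. I \<subseteq> A} |I::nat set. finite I}"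
    by (auto intro!: exI[of _ "{}"])
  show "emeasure M UNIV \<noteq> \<infinity>"
    using assms(4)[of "{}"] by simp
  show "sets M = sigma_sets UNIV {{A. I \<subseteq> A} |I. finite I}"
    unfolding assms(1) by (rule sets_cube)
  show "sets (cube p) = sigma_sets UNIV {{A. I \<subseteq> A} |I. finite I}"
    by (rule sets_cube)
qed auto

lemma sets_cube_vimage:
  assumes "F \<in> sets (cube p)" "g \<in> measurable (cube q) (cube p)"
  shows "{A. g A \<in> F} \<in> sets (cube q)"
  using measurable_sets[OF assms(2,1)] by (simp add: vimage_def)

lemma measurable_insert_cube [measurable]: "insert i \<in> measurable (cube p) (cube q)"
proof (rule measurable_cubeI)
  fix j
  show "{x \<in> space (cube p). j \<in> insert i x} \<in> sets (cube p)"
    using sets_cube_member[of j p] sets.top[of "cube p"] by (cases "j = i") auto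
qed

lemma sets_cube_finite_subset:
  assumes "finite I" shows "{A. A \<inter> I = J} \<in> sets (cube p)"
proof -
  have "{A. A \<inter> I = J} = (if J \<subseteq> I then {A. J \<subseteq> A} - (\<Union>i\<in>I-J. {A. i \<in> A}) else {})"
    by auto
  moreover have "J \<subseteq> I \<Longrightarrow> finite J" using assms finite_subset by auto
  ultimately show ?thesis using assms
    by (auto intro!: sets.Diff sets.finite_UN sets_cube_superset)
qed

lemma sets_cube_finite_pred:
  assumes "finite I" shows "{A. P (A \<inter> I)} \<in> sets (cube p)"
proof -
  have "{A. P (A \<inter> I)} = (\<Union>J\<in>{J. J \<subseteq> I \<and> P J}. {A. A \<inter> I = J})"
    by (rule set_eqI) (simp only: mem_Collect_eq UN_iff, auto)
  moreover have "\<dots> \<in> sets (cube p)"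
    using assms by (intro sets.finite_UN sets_cube_finite_subset) auto
  ultimately show ?thesis by simp
qed

lemma measurable_cube_localI:
  assumes "\<And>j. \<exists>I P. finite I \<and> (\<forall>A. j \<in> g A \<longleftrightarrow> P (A \<inter> I))"
  shows "g \<in> measurable (cube p) (cube q)"
proof (rule measurable_cubeI)
  fix j
  obtain I P where "finite I" "\<forall>A. j \<in> g A \<longleftrightarrow> P (A \<inter> I)" using assms by meson
  then show "{x \<in> space (cube p). j \<in> g x} \<in> sets (cube p)"
    using sets_cube_finite_pred[of I P p] by simp
qed

lemma measurable_remove_cube [measurable]: "(\<lambda>A. A - {i}) \<in> measurable (cube p) (cube q)"
  by (rule measurable_cube_localI) (rule_tac x = "{j}" in exI, rule_tac x = "\<lambda>B. j \<in> B \<and> j \<noteq> i" in exI, auto)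

lemma sets_insert_cube: "F \<in> sets (cube p) \<Longrightarrow> {A. insert i A \<in> F} \<in> sets (cube p)"
  by (rule sets_cube_vimage[OF _ measurable_insert_cube])

lemma sets_remove_cube: "F \<in> sets (cube p) \<Longrightarrow> {A. A - {i} \<in> F} \<in> sets (cube p)"
  by (rule sets_cube_vimage[OF _ measurable_remove_cube])

text \<open>Fubini for a single coordinate, without splitting the product: inserting and removing
  \<open>i\<close> are maps of the cube to itself, so both sections are again families on all points
  and can be resampled further.\<close>

lemma cube_resample:
  assumes "0 \<le> p" "p \<le> 1" "F \<in> sets (cube p)"
  shows "measure (cube p) F =
    p * measure (cube p) {A. insert i A \<in> F} + (1 - p) * measure (cube p) {A. A - {i} \<in> F}"
proof -
  interpret prob_space "cube p" by (rule prob_space_cube)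
  let ?E = "{{A. I \<subseteq> A} |I::nat set. finite I}"
  have "F \<in> sigma_sets UNIV ?E" using assms sets_cube by simp
  then show ?thesis
  proof (induction F rule: sigma_sets_induct_disjoint[OF Int_stable_superset subset_Pow_UNIV, consumes 1,
      case_names basic empty compl union])
    case (basic F)
    then obtain I where I: "F = {A. I \<subseteq> A}" "finite I" by auto
    have 1: "{A. insert i A \<in> F} = {A. I - {i} \<subseteq> A}" using I by auto
    have 2: "{A. A - {i} \<in> F} = (if i \<in> I then {} else {A. I \<subseteq> A})" using I by auto
    show ?case
    proof (cases "i \<in> I")
      case True
      then have "card I = Suc (card (I - {i}))" using I by (metis card_Suc_Diff1)
      then have "p ^ card I = p * p ^ card (I - {i})" by (metis power_Suc)
      then show ?thesis using True I(2) unfolding 1 2 unfolding I(1)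
        by (simp add: measure_cube_superset assms del: card_Diff_insert card_Diff_singleton)
    next
      case False
      then show ?thesis using I(2) unfolding 1 2 unfolding I(1)
        by (simp add: measure_cube_superset assms algebra_simps)
    qed
  next
    case empty then show ?case by simp
  next
    case (compl F)
    then have F: "F \<in> sets (cube p)" by (simp add: sets_cube)
    have c: "prob (UNIV - X) = 1 - prob X" if "X \<in> events" for X
      using prob_compl[OF that] by simp
    have "{A. insert i A \<in> UNIV - F} = UNIV - {A. insert i A \<in> F}"
      "{A. A - {i} \<in> UNIV - F} = UNIV - {A. A - {i} \<in> F}" by auto
    then show ?case
      using compl(2) by (simp only: c F sets_insert_cube sets_remove_cube) (simp add: algebra_simps)
  next
    case (union F)
    have F: "range F \<subseteq> sets (cube p)" using union by (simp add: sets_cube)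
    \<comment> \<open>Stated for a general \<open>g\<close> because it serves for insertion, for
      removal and for the identity.\<close>
    have s: "(\<lambda>n. prob {A. g A \<in> F n}) sums prob {A. g A \<in> \<Union>(range F)}"
      if g: "g \<in> measurable (cube p) (cube p)" for g
    proof -
      have "(\<lambda>n. prob {A. g A \<in> F n}) sums prob (\<Union>n. {A. g A \<in> F n})"
      proof (rule finite_measure_UNION)
        show "range (\<lambda>n. {A. g A \<in> F n}) \<subseteq> events"
          using F sets_cube_vimage[OF _ g] by auto
        show "disjoint_family (\<lambda>n. {A. g A \<in> F n})"
          using union(1) by (fastforce simp: disjoint_family_on_def)
      qed
      moreover have "(\<Union>n. {A. g A \<in> F n}) = {A. g A \<in> \<Union>(range F)}" by auto
      ultimately show ?thesis by simp
    qed
    have "(\<lambda>n. p * prob {A. insert i A \<in> F n} + (1 - p) * prob {A. A - {i} \<in> F n}) sums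
      (p * prob {A. insert i A \<in> \<Union>(range F)} + (1 - p) * prob {A. A - {i} \<in> \<Union>(range F)})"
      by (intro sums_add sums_mult s measurable_insert_cube measurable_remove_cube)
    moreover have "(\<lambda>n. prob (F n)) sums prob (\<Union>(range F))"
      using s[of "\<lambda>A. A"] by (simp only: measurable_ident_sets Collect_mem_eq)
    ultimately show ?case
      using union(3) by (simp add: sums_unique2)
  qed
qed

section \<open>Coupling, sections and approximation\<close>

definition cross_intersecting :: "nat set set \<Rightarrow> nat set set \<Rightarrow> bool" where
  "cross_intersecting P Q \<longleftrightarrow> (\<forall>A\<in>P. \<forall>B\<in>Q. A \<inter> B \<noteq> {})"

text \<open>The first \<open>n\<close> coordinates of \<open>C\<close> are overwritten rather than
  dropped, so a conditional measure is a measure in the same space.\<close>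

definition sec :: "nat \<Rightarrow> nat set set \<Rightarrow> nat set \<Rightarrow> nat set set" where
  "sec n F A = {C. (C - {..<n}) \<union> A \<in> F}"

text \<open>A version of \<open>finitely_determined\<close> that records the number of coordinates
  and carries no separate finite family; that family is
  \<open>Pow {..<n} \<inter> D\<close>.\<close>

definition determined :: "nat \<Rightarrow> nat set set \<Rightarrow> bool" where
  "determined n D \<longleftrightarrow> (\<forall>C. C \<inter> {..<n} \<in> D \<longleftrightarrow> C \<in> D)"

locale biased_cube =
  fixes p :: real
  assumes p_nonneg: "0 \<le> p" and p_le_1: "p \<le> 1"

sublocale biased_cube \<subseteq> prob_space "cube p"
  by (rule prob_space_cube)

context biased_cube
begin

lemma events_complement: "F \<in> events \<Longrightarrow> - F \<in> events"
  using sets.compl_sets[of F "cube p"] by (simp add: Compl_eq_Diff_UNIV)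

lemma prob_complement: "F \<in> events \<Longrightarrow> prob (- F) = 1 - prob F"
  using prob_compl[of F] by (simp add: Compl_eq_Diff_UNIV)

lemma resample:
  "F \<in> events \<Longrightarrow> prob F = p * prob {A. insert i A \<in> F} + (1 - p) * prob {A. A - {i} \<in> F}"
  by (rule cube_resample) (use p_nonneg p_le_1 in auto)

lemma prob_avoid:
  assumes "finite I" shows "prob {A. A \<inter> I = {}} = (1 - p) ^ card I"
  using assms
proof (induction I rule: finite_induct)
  case empty
  then show ?case using prob_space by simp
next
  case (insert i I)
  have "prob {A. A \<inter> insert i I = {}} = p * prob {A. insert i A \<inter> insert i I = {}}
      + (1 - p) * prob {A. (A - {i}) \<inter> insert i I = {}}"
    using sets_cube_finite_subset[of "insert i I" "{}" p] insert(1)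
    by (subst resample[of _ i]) auto
  moreover have "{A. insert i A \<inter> insert i I = {}} = {}" by auto
  moreover have "{A. (A - {i}) \<inter> insert i I = {}} = {A. A \<inter> I = {}}"
    using insert(2) by auto
  ultimately show ?case using insert by simp
qed

text \<open>If \<open>X\<close> and \<open>Z\<close> are independent with parameters \<open>p\<close> and \<open>p / (1 - p)\<close>, then \<open>Z - X\<close> has
  parameter \<open>p\<close> and is disjoint from \<open>X\<close>.\<close>

lemma disjoint_coupling:
  assumes "p \<le> 1/2"
  shows "distr (cube p \<Otimes>\<^sub>M cube (p / (1 - p))) (cube p) (\<lambda>(X, Z). Z - X) = cube p" (is "?D = _")
    and "(\<lambda>(X, Z). Z - X) \<in> measurable (cube p \<Otimes>\<^sub>M cube (p / (1 - p))) (cube p)"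
proof -
  define r where "r = p / (1 - p)"
  \<comment> \<open>The bound \<open>r \<le> 1\<close> is where \<open>p \<le> 1/2\<close>
    enters.\<close>
  have r: "0 \<le> r" "r \<le> 1" "r * (1 - p) = p"
    using assms p_nonneg by (auto simp: r_def field_simps)
  interpret r: biased_cube r by unfold_locales (use r in auto)
  have m: "(\<lambda>(X, Z). Z - X) \<in> measurable (cube p \<Otimes>\<^sub>M cube r) (cube p)"
  proof (rule measurable_cubeI)
    fix i :: nat
    have "{x \<in> space (cube p \<Otimes>\<^sub>M cube r). i \<in> (case x of (X, Z) \<Rightarrow> Z - X)} = (- {A. i \<in> A}) \<times> {A. i \<in> A}"
      by (auto simp: space_pair_measure)
    then show "{x \<in> space (cube p \<Otimes>\<^sub>M cube r). i \<in> (case x of (X, Z) \<Rightarrow> Z - X)} \<in> sets (cube p \<Otimes>\<^sub>M cube r)"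
      by (simp add: pair_measureI events_complement sets_cube_member)
  qed
  then show "(\<lambda>(X, Z). Z - X) \<in> measurable (cube p \<Otimes>\<^sub>M cube (p / (1 - p))) (cube p)"
    unfolding r_def .
  have "distr (cube p \<Otimes>\<^sub>M cube r) (cube p) (\<lambda>(X, Z). Z - X) = cube p"
  proof (rule cube_eqI)
    fix I :: "nat set" assume I: "finite I"
    have e: "(\<lambda>(X, Z). Z - X) -` {A. I \<subseteq> A} \<inter> space (cube p \<Otimes>\<^sub>M cube r)
        = {X. X \<inter> I = {}} \<times> {Z. I \<subseteq> Z}"
      by (auto simp: space_pair_measure)
    have "emeasure (distr (cube p \<Otimes>\<^sub>M cube r) (cube p) (\<lambda>(X, Z). Z - X)) {A. I \<subseteq> A}
        = emeasure (cube p) {X. X \<inter> I = {}} * emeasure (cube r) {Z. I \<subseteq> Z}"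
      using I unfolding emeasure_distr[OF m sets_cube_superset[OF I]] e
      by (intro r.emeasure_pair_measure_Times sets_cube_finite_subset sets_cube_superset)
    also have "\<dots> = ennreal ((1 - p) ^ card I) * ennreal (r ^ card I)"
      using I r by (simp add: emeasure_eq_measure prob_avoid emeasure_cube_superset)
    also have "\<dots> = ennreal (p ^ card I)"
      using r p_le_1 by (simp add: ennreal_mult[symmetric] power_mult_distrib[symmetric] mult.commute)
    finally show "emeasure (distr (cube p \<Otimes>\<^sub>M cube r) (cube p) (\<lambda>(X, Z). Z - X)) {A. I \<subseteq> A}
        = ennreal (p ^ card I)" .
  qed (simp_all add: p_nonneg p_le_1)
  then show "?D = cube p" unfolding r_def .
qed

text \<open>In the coupling, the events \<open>X \<in> P\<close> and \<open>Z - X \<in> Q\<close>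
  have the measures of \<open>P\<close> and \<open>Q\<close> and exclude each other.\<close>

lemma cross_intersecting_prob_le:
  assumes "p \<le> 1/2" "P \<in> events" "Q \<in> events" "cross_intersecting P Q"
  shows "prob P + prob Q \<le> 1"
proof -
  define r where "r = p / (1 - p)"
  let ?M = "cube p \<Otimes>\<^sub>M cube r" and ?g = "\<lambda>(X::nat set, Z::nat set). Z - X"
  have r: "0 \<le> r" "r \<le> 1"
    using assms p_nonneg by (auto simp: r_def field_simps)
  interpret r: biased_cube r by unfold_locales (use r in auto)
  interpret pair: pair_prob_space "cube p" "cube r" by unfold_locales
  note c = disjoint_coupling[OF assms(1), folded r_def]
  have "prob Q = measure ?M (?g -` Q \<inter> space ?M)"
    using measure_distr[OF c(2) assms(3)] unfolding c(1) by simp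
  moreover have "prob P = measure ?M (P \<times> UNIV)"
  proof -
    have "emeasure ?M (P \<times> space (cube r)) = emeasure (cube p) P * emeasure (cube r) (space (cube r))"
      by (intro r.emeasure_pair_measure_Times) (use assms sets.top[of "cube r"] in simp_all)
    then show ?thesis
      using r.emeasure_space_1 by (simp add: measure_def)
  qed
  moreover have "P \<times> UNIV \<inter> (?g -` Q \<inter> space ?M) = {}"
    using assms(4) by (fastforce simp: cross_intersecting_def)
  moreover have "P \<times> UNIV \<in> sets ?M"
    using pair_measureI[OF assms(2), of UNIV "cube r"] sets.top[of "cube r"] by simp
  moreover have "?g -` Q \<inter> space ?M \<in> sets ?M"
    using measurable_sets[OF c(2) assms(3)] .
  ultimately have "prob P + prob Q = measure ?M (P \<times> UNIV \<union> (?g -` Q \<inter> space ?M))"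
    by (subst pair.finite_measure_Union) auto
  also have "\<dots> \<le> 1" by (rule pair.prob_le_1)
  finally show ?thesis .
qed

section \<open>Conditioning on an initial segment, rounding and approximation\<close>

definition weight :: "nat \<Rightarrow> nat set \<Rightarrow> real" where
  "weight n A = p ^ card A * (1 - p) ^ (n - card A)"

lemma weight_nonneg: "0 \<le> weight n A"
  using p_nonneg p_le_1 by (simp add: weight_def)

lemma sec_events:
  assumes "F \<in> events" shows "sec n F A \<in> events"
  unfolding sec_def
proof (rule sets_cube_vimage[OF assms measurable_cubeI])
  fix i
  show "{C \<in> space (cube p). i \<in> C - {..<n} \<union> A} \<in> events"
    using sets_cube_member[of i p] sets.top[of "cube p"] by (cases "i \<in> A"; cases "i < n") auto
qed

lemma prob_sections:
  assumes "F \<in> events"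
  shows "prob F = (\<Sum>A\<in>Pow {..<n}. weight n A * prob (sec n F A))"
proof (induction n)
  case 0
  show ?case by (simp add: sec_def weight_def)
next
  case (Suc n)
  have f: "finite A" "card A \<le> n" if "A \<in> Pow {..<n}" for A
    using that card_mono[of "{..<n}" A] finite_subset[of A "{..<n}"] by auto
  have "prob F = (\<Sum>A\<in>Pow {..<n}. weight n A * prob (sec n F A))" by (rule Suc)
  also have "\<dots> = (\<Sum>A\<in>Pow {..<n}. weight (Suc n) A * prob (sec (Suc n) F A)
      + weight (Suc n) (insert n A) * prob (sec (Suc n) F (insert n A)))"
  proof (rule sum.cong[OF refl])
    fix A assume A: "A \<in> Pow {..<n}"
    have "{C. insert n C \<in> sec n F A} = sec (Suc n) F (insert n A)"
      "{C. C - {n} \<in> sec n F A} = sec (Suc n) F A"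
    proof -
      have 1: "insert n C - {..<n} \<union> A = C - {..<Suc n} \<union> insert n A"
        "C - {n} - {..<n} \<union> A = C - {..<Suc n} \<union> A" for C by auto
      show "{C. insert n C \<in> sec n F A} = sec (Suc n) F (insert n A)"
        "{C. C - {n} \<in> sec n F A} = sec (Suc n) F A"
        by (simp_all only: sec_def mem_Collect_eq 1)
    qed
    then have "prob (sec n F A) = p * prob (sec (Suc n) F (insert n A))
        + (1 - p) * prob (sec (Suc n) F A)"
      using resample[OF sec_events[OF assms], of n A n] by simp
    moreover have "weight (Suc n) A = (1 - p) * weight n A"
      "weight (Suc n) (insert n A) = p * weight n A"
    proof -
      have "n \<notin> A" using A by auto
      then show "weight (Suc n) A = (1 - p) * weight n A"
        "weight (Suc n) (insert n A) = p * weight n A"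
        using f[OF A] by (auto simp: weight_def Suc_diff_le)
    qed
    ultimately show "weight n A * prob (sec n F A) = weight (Suc n) A * prob (sec (Suc n) F A)
      + weight (Suc n) (insert n A) * prob (sec (Suc n) F (insert n A))"
      by (simp only:) (simp add: algebra_simps)
  qed
  also have "\<dots> = (\<Sum>A\<in>Pow {..<Suc n}. weight (Suc n) A * prob (sec (Suc n) F A))"
  proof -
    have "inj_on (insert n) (Pow {..<n})"
      by (rule inj_onI) (metis PowD insert_ident lessThan_iff less_irrefl subsetD)
    moreover have "Pow {..<n} \<inter> insert n ` Pow {..<n} = {}" by auto
    ultimately show ?thesis
      unfolding lessThan_Suc Pow_insert
      by (simp add: sum.union_disjoint sum.reindex sum.distrib)
  qed
  finally show ?case .
qed

lemma determined_events: "determined n D \<Longrightarrow> D \<in> events"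
  using sets_cube_finite_pred[of "{..<n}" "\<lambda>B. B \<in> D" p] by (simp add: determined_def)

lemma determined_mono:
  assumes "determined n D" "n \<le> m" shows "determined m D"
  unfolding determined_def
proof
  fix C
  have "C \<inter> {..<m} \<inter> {..<n} = C \<inter> {..<n}" using assms(2) by auto
  then show "C \<inter> {..<m} \<in> D \<longleftrightarrow> C \<in> D" using assms(1) unfolding determined_def by metis
qed

lemma determined_Collect: "determined n {C. P (C \<inter> {..<n})}"
  by (simp add: determined_def Int_assoc)

lemma sec_determined:
  assumes "determined n D" "A \<subseteq> {..<n}"
  shows "sec n D A = (if A \<in> D then UNIV else {})"
proof -
  have "(C - {..<n} \<union> A) \<inter> {..<n} = A" for C using assms(2) by auto
  then have "C - {..<n} \<union> A \<in> D \<longleftrightarrow> A \<in> D" for C using assms(1) unfolding determined_def by metis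
  then show ?thesis by (auto simp: sec_def)
qed

lemma prob_UNIV: "prob UNIV = 1"
  using prob_space by simp

lemma prob_determined:
  assumes "determined n D"
  shows "prob D = (\<Sum>A\<in>Pow {..<n} \<inter> D. weight n A)"
proof -
  have "prob D = (\<Sum>A\<in>Pow {..<n}. if A \<in> D then weight n A else 0)"
    by (subst prob_sections[OF determined_events[OF assms], of n])
       (intro sum.cong, auto simp: sec_determined[OF assms] prob_UNIV)
  then show ?thesis by (simp add: sum.inter_restrict)
qed

lemma prob_sym_diff_determined:
  assumes "determined n D" "F \<in> events"
  shows "prob (sym_diff F D) =
    (\<Sum>A\<in>Pow {..<n}. weight n A * (if A \<in> D then 1 - prob (sec n F A) else prob (sec n F A)))"
proof -
  have "sec n (sym_diff F D) A = (if A \<in> D then - sec n F A else sec n F A)" if "A \<subseteq> {..<n}" for A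
    using sec_determined[OF assms(1) that] by (auto simp: sec_def set_eq_iff split: if_splits)
  then show ?thesis
    using assms determined_events[OF assms(1)] 
    by (subst prob_sections[of _ n]) 
      (auto intro!: sum.cong simp: prob_complement sec_events)
qed

text \<open>The inequality is strict because conflicting sections are only known to have measures
  with sum at most 1, so both could be exactly 1/2.\<close>

definition rounding :: "nat \<Rightarrow> nat set set \<Rightarrow> nat set set" where
  "rounding n F = {C. prob (sec n F (C \<inter> {..<n})) > 1/2}"

lemma determined_rounding: "determined n (rounding n F)"
  unfolding rounding_def by (rule determined_Collect)

text \<open>On each trace a determined family errs by f or by 1 - f, where f is the measure of the
  section; rounding picks the smaller of the two.\<close>

lemma prob_sym_diff_rounding_le:
  assumes "determined n D" "F \<in> events"
  shows "prob (sym_diff F (rounding n F)) \<le> prob (sym_diff F D)"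
  unfolding prob_sym_diff_determined[OF assms]
    prob_sym_diff_determined[OF determined_rounding assms(2)]
  by (intro sum_mono mult_left_mono weight_nonneg) (auto simp: rounding_def Int_absorb2)

text \<open>The families with this property contain the generating cylinders and are closed under
  complements and countable disjoint unions.\<close>

lemma events_approx:
  assumes "F \<in> events" "e > 0"
  shows "\<exists>n D. determined n D \<and> prob (sym_diff F D) < e"
proof -
  have "F \<in> sigma_sets UNIV {{A. I \<subseteq> A} |I::nat set. finite I}" using assms sets_cube by simp
  then show ?thesis using \<open>e > 0\<close>
  proof (induction F arbitrary: e rule: sigma_sets_induct_disjoint[OF Int_stable_superset subset_Pow_UNIV,
      consumes 1, case_names basic empty compl union])
    case (basic F)
    then obtain I where I: "F = {A. I \<subseteq> A}" "finite I" by auto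
    then obtain n where "I \<subseteq> {..<n}" using finite_nat_iff_bounded by auto
    then have "determined n F" unfolding I determined_def by auto
    then show ?case using basic by (intro exI[of _ n] exI[of _ F]) auto
  next
    case empty
    then show ?case by (intro exI[of _ 0] exI[of _ "{}"]) (auto simp: determined_def)
  next
    case (compl F)
    then obtain n D where D: "determined n D" "prob (sym_diff F D) < e" by blast
    moreover have "sym_diff (UNIV - F) (- D) = sym_diff F D" by auto
    ultimately show ?case
      by (intro exI[of _ n] exI[of _ "- D"]) (auto simp: determined_def)
  next
    case (union F)
    have F: "range F \<subseteq> events" using union by (simp add: sets_cube)
    have "(\<lambda>i. prob (F i)) sums prob (\<Union>(range F))"
      using finite_measure_UNION[OF F union(1)] .
    then have "(\<lambda>N. \<Sum>i<N. prob (F i)) \<longlonglongrightarrow> prob (\<Union>(range F))" by (simp add: sums_def)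
    then have "\<forall>\<^sub>F N in sequentially. prob (\<Union>(range F)) - e/2 < (\<Sum>i<N. prob (F i))"
      by (rule order_tendstoD) (use union in simp)
    then obtain N where N: "prob (\<Union>(range F)) - e/2 < (\<Sum>i<N. prob (F i))"
      by (auto simp: eventually_sequentially)
    \<comment> \<open>The \<open>N\<close> errors add up to at most \<open>e / 2\<close>; the tail
      of the union accounts for the other half. Adding 1 to \<open>N\<close> keeps the denominator
      positive.\<close>
    have "\<exists>n D. determined n D \<and> prob (sym_diff (F i) D) < e / (2 * (real N + 1))" for i
      using union(4) by (intro union(3)) auto
    then obtain n D where D: "\<And>i. determined (n i) (D i)"
      "\<And>i. prob (sym_diff (F i) (D i)) < e / (2 * (real N + 1))" by metis
    \<comment> \<open>The sum serves merely as a common upper bound of the lengths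
      \<open>n i\<close>.\<close>
    have det: "determined (\<Sum>i<N. n i) (\<Union>i<N. D i)"
    proof -
      have "determined (\<Sum>i<N. n i) (D i)" if "i < N" for i
        by (rule determined_mono[OF D(1)]) (use that member_le_sum[of i "{..<N}" n] in auto)
      then show ?thesis unfolding determined_def by auto
    qed
    have ev: "F i \<in> events" "sym_diff (F i) (D i) \<in> events" for i
      using F determined_events[OF D(1)[of i]] by auto
    have "(\<Sum>i<N. prob (F i)) = prob (\<Union>i<N. F i)"
      using F union(1) by (subst finite_measure_finite_Union) (auto simp: disjoint_family_on_def)
    then have 1: "prob (\<Union>(range F) - (\<Union>i<N. F i)) < e/2"
      using N ev by (subst finite_measure_Diff) auto
    have "prob (\<Union>i<N. sym_diff (F i) (D i)) \<le> (\<Sum>i<N. prob (sym_diff (F i) (D i)))"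
      using ev by (intro finite_measure_subadditive_finite) auto
    also have "\<dots> \<le> (\<Sum>i<N. e / (2 * (real N + 1)))"
      by (intro sum_mono less_imp_le D)
    also have "\<dots> \<le> e / 2"
      using union(4) by (simp add: field_simps)
    finally have 2: "prob (\<Union>i<N. sym_diff (F i) (D i)) \<le> e/2" .
    have "prob (sym_diff (\<Union>(range F)) (\<Union>i<N. D i))
        \<le> prob ((\<Union>(range F) - (\<Union>i<N. F i)) \<union> (\<Union>i<N. sym_diff (F i) (D i)))"
      using ev by (intro finite_measure_mono sets.Un sets.Diff) auto
    also have "\<dots> \<le> prob (\<Union>(range F) - (\<Union>i<N. F i)) + prob (\<Union>i<N. sym_diff (F i) (D i))"
      using ev by (intro measure_Un_le sets.Diff) auto
    also have "\<dots> < e" using 1 2 by simp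
    finally show ?case using det by blast
  qed
qed

end

section \<open>An isoperimetric inequality for cross-intersecting families\<close>

text \<open>If \<open>X\<close> and \<open>Y\<close> in the two sections were disjoint, the
  corresponding members of \<open>F\<close> and \<open>G\<close> would meet exactly in
  \<open>A \<inter> B\<close>.\<close>

lemma sec_cross_intersecting:
  assumes "\<And>X Y. X \<in> F \<Longrightarrow> Y \<in> G \<Longrightarrow> R (X \<inter> Y)"
    and "A \<subseteq> {..<n}" "B \<subseteq> {..<n}" "\<not> R (A \<inter> B)"
  shows "cross_intersecting (sec n F A) (sec n G B)"
  unfolding cross_intersecting_def
proof (intro ballI notI)
  fix X Y assume XY: "X \<in> sec n F A" "Y \<in> sec n G B" "X \<inter> Y = {}"
  have "(X - {..<n} \<union> A) \<inter> (Y - {..<n} \<union> B) = A \<inter> B"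
    using assms(2,3) XY(3) by auto
  then show False using assms(1)[of "X - {..<n} \<union> A" "Y - {..<n} \<union> B"] assms(4) XY(1,2)
    by (simp add: sec_def)
qed

definition at_least :: "nat \<Rightarrow> nat set \<Rightarrow> bool" where
  "at_least t X \<longleftrightarrow> infinite X \<or> t \<le> card X"

lemma at_least_mono: "at_least t X \<Longrightarrow> X \<subseteq> Y \<Longrightarrow> at_least t Y"
  unfolding at_least_def by (metis card_mono finite_subset le_trans)

lemma at_least_1: "at_least 1 X \<longleftrightarrow> X \<noteq> {}"
  by (cases "finite X") (auto simp: at_least_def Suc_le_eq card_gt_0_iff)

lemma t_intersecting_at_least: "t_intersecting t F \<longleftrightarrow> (\<forall>A\<in>F. \<forall>B\<in>F. at_least t (A \<inter> B))"
  by (simp add: t_intersecting_def at_least_def)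

text \<open>The left side minus the right side first decreases and then increases in \<open>z\<close>, so it
  suffices to compare at \<open>z = 0\<close> and \<open>z = 1\<close>.\<close>

lemma two_point_inequality_aux:
  fixes p \<gamma> z :: real
  assumes "0 < p" "p < 1" "1 < \<gamma>" "p \<le> (1 - p) powr \<gamma>" "0 \<le> z" "z \<le> 1"
  shows "(1 - p) * z powr \<gamma> + p \<le> ((1 - p) + p * z) powr \<gamma>"
proof (rule ccontr)
  define f where "f x = ((1 - p) + p * x) powr \<gamma> - (1 - p) * x powr \<gamma> - p" for x
  define f' where "f' x = \<gamma> * (p * ((1 - p) + p * x) powr (\<gamma> - 1) - (1 - p) * x powr (\<gamma> - 1))" for x
  assume "\<not> ?thesis"
  then have neg: "f z < 0" by (simp add: f_def)
  \<comment> \<open>The hypothesis \<open>p \<le> (1 - p) powr \<gamma>\<close> says precisely that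
    \<open>f 0 \<ge> 0\<close>.\<close>
  have f0: "f 0 \<ge> 0" "f 1 = 0" using assms by (auto simp: f_def)
  then have z: "0 < z" "z < 1" using neg assms by (metis less_eq_real_def not_less)+
  have cont: "continuous_on {0..1} f"
    unfolding f_def using assms
    by (intro continuous_intros continuous_on_powr') (auto simp: add_nonneg_eq_0_iff)
  have der: "(f has_real_derivative f' x) (at x)" if "0 < x" for x
  proof -
    have "0 < 1 - p + p * x" using assms that by (simp add: add_pos_pos)
    then show ?thesis
      unfolding f_def f'_def using that assms
      by (auto intro!: derivative_eq_intros simp: algebra_simps)
  qed
  have "\<exists>l a. 0 < a \<and> a < z \<and> DERIV f a :> l \<and> f z - f 0 = (z - 0) * l"
  proof (rule MVT)
    show "continuous_on {0..z} f" by (rule continuous_on_subset[OF cont]) (use z in auto)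
    show "f differentiable (at x)" if "0 < x" for x
      using der[OF that] real_differentiable_def by blast
  qed (rule z)
  then obtain l a where a: "0 < a" "a < z" "DERIV f a :> l" "f z - f 0 = (z - 0) * l" by blast
  have "\<exists>m b. z < b \<and> b < 1 \<and> DERIV f b :> m \<and> f 1 - f z = (1 - z) * m"
  proof (rule MVT)
    show "continuous_on {z..1} f" by (rule continuous_on_subset[OF cont]) (use z in auto)
    show "f differentiable (at x)" if "z < x" for x
      using der[of x] that z real_differentiable_def by fastforce
  qed (rule z)
  then obtain m b where b: "z < b" "b < 1" "DERIV f b :> m" "f 1 - f z = (1 - z) * m" by blast
  have "l = f' a" "m = f' b" 
    using DERIV_unique[OF a(3) der] DERIV_unique[OF b(3) der] a b z by auto
  moreover have "l < 0" using a(4) f0 neg z by (smt (verit) mult_nonneg_nonneg)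
  moreover have "m > 0" using b(4) f0 neg z by (smt (verit) mult_nonneg_nonpos)
  ultimately have "f' a < 0" "f' b > 0" by auto
  then have ab: "p * ((1 - p) + p * a) powr (\<gamma> - 1) < (1 - p) * a powr (\<gamma> - 1)"
    "p * ((1 - p) + p * b) powr (\<gamma> - 1) > (1 - p) * b powr (\<gamma> - 1)"
    using assms by (auto simp: f'_def mult_less_0_iff zero_less_mult_iff)
  \<comment> \<open>For x > 0 the sign of \<open>f' x\<close> is that of p * (((1 - p) + p * x) / x)
    powr (\<gamma> - 1) - (1 - p), which decreases in x. So \<open>f' a < 0 < f' b\<close> with
    \<open>a < b\<close> is impossible; cross-multiplication makes this comparison without the
    quotient.\<close>
  have "p * (((1 - p) + p * a) powr (\<gamma> - 1) * b powr (\<gamma> - 1)) < (1 - p) * a powr (\<gamma> - 1) * b powr (\<gamma> - 1)"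
    using ab(1) a b z by (simp add: mult.assoc[symmetric] mult_strict_right_mono)
  also have "\<dots> < p * (((1 - p) + p * b) powr (\<gamma> - 1) * a powr (\<gamma> - 1))"
    using mult_strict_right_mono[OF ab(2), of "a powr (\<gamma> - 1)"] a b z by (simp add: mult_ac)
  finally have "(((1 - p) + p * a) * b) powr (\<gamma> - 1) < (((1 - p) + p * b) * a) powr (\<gamma> - 1)"
    using assms a b z by (simp add: powr_mult)
  then have "((1 - p) + p * a) * b < ((1 - p) + p * b) * a"
    using assms a b z powr_mono2[of "\<gamma> - 1" "((1 - p) + p * b) * a" "((1 - p) + p * a) * b"]
    by (smt (verit) mult_nonneg_nonneg)
  then have "(1 - p) * b < (1 - p) * a" by (simp add: algebra_simps)
  then show False using assms a b by (simp add: mult_less_cancel_left)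
qed

text \<open>The induction step for the isoperimetric inequality. Here \<open>x0\<close>,
  \<open>x1\<close> are the measures of the sections of \<open>P\<close> without and with the last
  coordinate, and \<open>y0\<close>, \<open>y1\<close> the complementary measures for
  \<open>Q\<close>. Nothing bounds \<open>x1\<close> by \<open>y1\<close>, since sets that both
  contain the coordinate already meet.\<close>

lemma two_point_inequality:
  fixes p \<gamma> x0 x1 y0 y1 :: real
  assumes p: "0 < p" "p < 1" "1 < \<gamma>" "p \<le> (1 - p) powr \<gamma>"
    and y: "0 \<le> y0" "0 \<le> y1"
    and x: "x0 \<le> y0 powr \<gamma>" "x0 \<le> y1 powr \<gamma>" "x1 \<le> y0 powr \<gamma>"
  shows "p * x1 + (1 - p) * x0 \<le> (p * y1 + (1 - p) * y0) powr \<gamma>"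
proof (cases "y0 \<le> y1")
  case True
  have "p * x1 + (1 - p) * x0 \<le> p * y0 powr \<gamma> + (1 - p) * y0 powr \<gamma>"
    using p x by (intro add_mono mult_left_mono) auto
  also have "\<dots> = (p * y0 + (1 - p) * y0) powr \<gamma>" by (simp add: algebra_simps)
  also have "\<dots> \<le> (p * y1 + (1 - p) * y0) powr \<gamma>"
    using p y True by (intro powr_mono2 add_mono mult_left_mono add_nonneg_nonneg mult_nonneg_nonneg) auto
  finally show ?thesis .
next
  case False
  then have y0: "0 < y0" using y by simp
  have "p * x1 + (1 - p) * x0 \<le> p * y0 powr \<gamma> + (1 - p) * y1 powr \<gamma>"
    using p x by (intro add_mono mult_left_mono) auto
  \<comment> \<open>Both sides are homogeneous of degree \<open>\<gamma>\<close>, so one may scale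
    to \<open>y0 = 1\<close> with \<open>z = y1 / y0\<close>.\<close>
  also have "\<dots> = ((1 - p) * (y1 / y0) powr \<gamma> + p) * y0 powr \<gamma>"
    using y y0 by (simp add: powr_divide field_simps)
  also have "\<dots> \<le> ((1 - p) + p * (y1 / y0)) powr \<gamma> * y0 powr \<gamma>"
    using two_point_inequality_aux[OF p, of "y1 / y0"] False y y0 by (intro mult_right_mono) auto
  also have "\<dots> = (((1 - p) + p * (y1 / y0)) * y0) powr \<gamma>"
    using p y y0 by (subst powr_mult) auto
  also have "((1 - p) + p * (y1 / y0)) * y0 = p * y1 + (1 - p) * y0"
    using y0 by (simp add: field_simps)
  finally show ?thesis .
qed

context biased_cube
begin

lemma prob_diff_le_sym_diff:
  assumes "F \<in> events" "D \<in> events"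
  shows "\<bar>prob F - prob D\<bar> \<le> prob (sym_diff F D)"
proof -
  have "prob F \<le> prob (D \<union> sym_diff F D)" "prob D \<le> prob (F \<union> sym_diff F D)"
    using assms by (auto intro!: finite_measure_mono)
  moreover have "prob (D \<union> sym_diff F D) \<le> prob D + prob (sym_diff F D)"
    "prob (F \<union> sym_diff F D) \<le> prob F + prob (sym_diff F D)"
    using assms by (auto intro!: measure_Un_le)
  ultimately show ?thesis by linarith
qed

text \<open>Formulated for two families, since it also carries cross-intersection (with
  \<open>t = 1\<close>) over to the roundings in \<open>cross_intersecting_powr\<close>.\<close>

lemma rounding_intersections:
  assumes "p \<le> 1/2" "F \<in> events" "G \<in> events"
    and "\<And>X Y. X \<in> F \<Longrightarrow> Y \<in> G \<Longrightarrow> at_least t (X \<inter> Y)"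
    and "X \<in> rounding n F" "Y \<in> rounding n G"
  shows "at_least t (X \<inter> Y)"
proof (rule ccontr)
  assume "\<not> at_least t (X \<inter> Y)"
  then have "\<not> at_least t ((X \<inter> {..<n}) \<inter> (Y \<inter> {..<n}))"
    using at_least_mono by (metis Int_lower1 inf_assoc inf_left_commute)
  then have "cross_intersecting (sec n F (X \<inter> {..<n})) (sec n G (Y \<inter> {..<n}))"
    by (intro sec_cross_intersecting[where R = "at_least t"] assms(4)) auto
  then have "prob (sec n F (X \<inter> {..<n})) + prob (sec n G (Y \<inter> {..<n})) \<le> 1"
    using assms by (intro cross_intersecting_prob_le sec_events)
  then show False using assms(5,6) by (simp add: rounding_def)
qed

lemma t_intersecting_rounding:
  assumes "p \<le> 1/2" "F \<in> events" "t_intersecting t F"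
  shows "t_intersecting t (rounding n F)"
  using rounding_intersections[OF assms(1,2,2)] assms(3) by (simp add: t_intersecting_at_least)

lemma rounding_approx:
  assumes "F \<in> events" "e > 0"
  shows "\<exists>n0. \<forall>n\<ge>n0. \<bar>prob F - prob (rounding n F)\<bar> < e"
proof -
  obtain n0 D where D: "determined n0 D" "prob (sym_diff F D) < e"
    using events_approx[OF assms] by blast
  have "\<bar>prob F - prob (rounding n F)\<bar> < e" if "n \<ge> n0" for n
    using prob_diff_le_sym_diff[OF assms(1) determined_events[OF determined_rounding]]
      prob_sym_diff_rounding_le[OF determined_mono[OF D(1) that] assms(1)] D(2)
    by (meson le_less_trans)
  then show ?thesis by blast
qed

lemma rounding_tendsto:
  assumes "F \<in> events"
  shows "(\<lambda>n. prob (rounding n F)) \<longlonglongrightarrow> prob F"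
  using rounding_approx[OF assms] by (simp add: LIMSEQ_def dist_real_def abs_minus_commute)

text \<open>The condition on \<open>\<gamma>\<close> is the inequality itself for
  \<open>P = Q = {A. i \<in> A}\<close>. Induction on \<open>n\<close> propagates it: three of the
  four pairs of sections at the last coordinate are again cross-intersecting.\<close>

lemma cross_intersecting_powr_determined:
  assumes p: "0 < p" "p < 1" "1 < \<gamma>" "p \<le> (1 - p) powr \<gamma>"
    and "determined n P" "determined n Q" "cross_intersecting P Q"
  shows "prob P \<le> (1 - prob Q) powr \<gamma>"
  using assms(5-)
proof (induction n arbitrary: P Q)
  case 0
  \<comment> \<open>Without coordinates a family is empty or everything, and the empty set cannot
    lie in both \<open>P\<close> and \<open>Q\<close>.\<close>
  then have "P = {} \<or> Q = {}" by (auto simp: determined_def cross_intersecting_def)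
  then show ?case by auto
next
  case (Suc n)
  let ?a = "\<lambda>F. {A. A - {n} \<in> F}" and ?b = "\<lambda>F. {A. insert n A \<in> F}"
  have det: "determined n (?a F)" "determined n (?b F)" if "determined (Suc n) F" for F :: "nat set set"
  proof -
    have "C - {n} \<in> F \<longleftrightarrow> C \<inter> {..<n} - {n} \<in> F" "insert n C \<in> F \<longleftrightarrow> insert n (C \<inter> {..<n}) \<in> F" for C
    proof -
      have "(C - {n}) \<inter> {..<Suc n} = (C \<inter> {..<n} - {n}) \<inter> {..<Suc n}"
        "insert n C \<inter> {..<Suc n} = insert n (C \<inter> {..<n}) \<inter> {..<Suc n}" by auto
      then show "C - {n} \<in> F \<longleftrightarrow> C \<inter> {..<n} - {n} \<in> F"
        "insert n C \<in> F \<longleftrightarrow> insert n (C \<inter> {..<n}) \<in> F"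
        using that unfolding determined_def by metis+
    qed
    then show "determined n (?a F)" "determined n (?b F)" by (auto simp: determined_def)
  qed
  have cr: "cross_intersecting (?a P) (?a Q)" "cross_intersecting (?a P) (?b Q)"
    "cross_intersecting (?b P) (?a Q)"
    using Suc.prems(3) unfolding cross_intersecting_def by fastforce+
  have ev: "P \<in> events" "Q \<in> events" using Suc.prems determined_events by auto
  have "prob P = p * prob (?b P) + (1 - p) * prob (?a P)" by (rule resample[OF ev(1)])
  also have "\<dots> \<le> (p * (1 - prob (?b Q)) + (1 - p) * (1 - prob (?a Q))) powr \<gamma>"
    using Suc.IH det Suc.prems cr p by (intro two_point_inequality) auto
  also have "p * (1 - prob (?b Q)) + (1 - p) * (1 - prob (?a Q)) = 1 - prob Q"
    by (subst resample[OF ev(2), of n]) (simp add: algebra_simps)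
  finally show ?case .
qed

lemma cross_intersecting_powr:
  assumes p: "0 < p" "p \<le> 1/2" "1 < \<gamma>" "p \<le> (1 - p) powr \<gamma>"
    and "P \<in> events" "Q \<in> events" "cross_intersecting P Q"
  shows "prob P \<le> (1 - prob Q) powr \<gamma>"
proof (rule LIMSEQ_le[OF rounding_tendsto])
  show "(\<lambda>n. (1 - prob (rounding n Q)) powr \<gamma>) \<longlonglongrightarrow> (1 - prob Q) powr \<gamma>"
    using assms by (intro tendsto_powr' tendsto_intros rounding_tendsto) auto
  have "prob (rounding n P) \<le> (1 - prob (rounding n Q)) powr \<gamma>" for n
  proof (rule cross_intersecting_powr_determined[OF p(1) _ p(3,4) determined_rounding determined_rounding])
    show "cross_intersecting (rounding n P) (rounding n Q)"
      using rounding_intersections[OF p(2) assms(5,6), of 1 _ n] assms(7)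
      unfolding at_least_1 cross_intersecting_def by blast
  qed (use p in simp)
  then show "\<exists>N. \<forall>n\<ge>N. prob (rounding n P) \<le> (1 - prob (rounding n Q)) powr \<gamma>" by blast
qed (rule assms)

end

section \<open>Binomial estimates and compressions\<close>

lemma central_binomial_Suc:
  "(Suc m) * ((2 * Suc m) choose (Suc m)) = 2 * (2 * m + 1) * ((2 * m) choose m)"
proof -
  have "2 * Suc m = Suc (2 * m + 1)" by simp
  then have "Suc m * ((2 * Suc m) choose (Suc m)) = Suc (2 * m + 1) * ((2 * m + 1) choose m)"
    by (simp only: Suc_times_binomial)
  also have "(2 * m + 1) choose m = (Suc (2 * m) choose Suc m)"
    using binomial_symmetric[of m "2 * m + 1"] by simp
  also have "Suc (2 * m + 1) * (Suc (2 * m) choose Suc m) = 2 * (Suc m * (Suc (2 * m) choose Suc m))"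
    by simp
  also have "Suc m * (Suc (2 * m) choose Suc m) = Suc (2 * m) * ((2 * m) choose m)"
    by (rule Suc_times_binomial)
  finally show ?thesis by simp
qed

text \<open>From m to m + 1 the left side is multiplied by (2m + 1)(2m + 3) / (2m + 2)^2 < 1. This
  gives decay of order 1 / sqrt m without Stirling's formula.\<close>

lemma central_binomial_square_le:
  "(real ((2 * m) choose m) / 4 ^ m)\<^sup>2 * (2 * m + 1) \<le> 1"
proof (induction m)
  case 0 then show ?case by simp
next
  case (Suc m)
  define r where "r = real ((2 * m) choose m) / 4 ^ m"
  define c where "c = real ((2 * Suc m) choose (Suc m))"
  have "real (Suc m * ((2 * Suc m) choose (Suc m))) = real (2 * (2 * m + 1) * ((2 * m) choose m))"
    by (simp only: central_binomial_Suc)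
  then have "(real m + 1) * c = 2 * (2 * m + 1) * real ((2 * m) choose m)"
    unfolding c_def of_nat_mult by (simp add: algebra_simps)
  then have "c = 2 * (2 * m + 1) * real ((2 * m) choose m) / (real m + 1)"
    by (simp add: eq_divide_eq mult.commute)
  then have "c / 4 ^ Suc m = r * ((2 * m + 1) / (2 * m + 2))"
    by (simp add: r_def divide_simps) (simp add: algebra_simps)
  then have e: "real ((2 * Suc m) choose (Suc m)) / 4 ^ Suc m = r * ((2 * m + 1) / (2 * m + 2))"
    unfolding c_def .
  have "((2 * real m + 1) / (2 * m + 2))\<^sup>2 * (2 * Suc m + 1) \<le> 2 * m + 1"
  proof -
    define x where "x = 2 * real m + 1"
    have x: "x > 0" by (simp add: x_def)
    have "x\<^sup>2 * (x + 2) \<le> x * (x + 1)\<^sup>2"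
      using x by (simp add: power2_eq_square algebra_simps)
    then have "(x / (x + 1))\<^sup>2 * (x + 2) \<le> x"
      using x by (simp add: power_divide pos_divide_le_eq)
    then show ?thesis by (simp add: x_def add.commute)
  qed
  then have "r\<^sup>2 * (((2 * real m + 1) / (2 * m + 2))\<^sup>2 * (2 * Suc m + 1)) \<le> r\<^sup>2 * (2 * m + 1)"
    by (intro mult_left_mono) auto
  also have "\<dots> \<le> 1" using Suc by (simp add: r_def)
  finally show ?case unfolding e power_mult_distrib mult.assoc by (simp add: add.commute)
qed

lemma central_binomial_small:
  assumes "e > 0"
  shows "\<exists>m0. \<forall>m\<ge>m0. real ((2 * m) choose m) < e * 2 ^ (2 * m)"
proof -
  obtain m0 :: nat where m0: "1 / e\<^sup>2 < m0" using reals_Archimedean2 by blast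
  have "real ((2 * m) choose m) < e * 2 ^ (2 * m)" if "m \<ge> m0" for m
  proof (rule ccontr)
    assume "\<not> ?thesis"
    then have "e \<le> real ((2 * m) choose m) / 4 ^ m"
      by (simp add: pos_le_divide_eq power_mult not_less)
    then have "e\<^sup>2 * (2 * m + 1) \<le> (real ((2 * m) choose m) / 4 ^ m)\<^sup>2 * (2 * m + 1)"
      using assms by (intro mult_right_mono power_mono) auto
    then have "e\<^sup>2 * (2 * m + 1) \<le> 1"
      using central_binomial_square_le[of m] by linarith
    moreover have "1 < e\<^sup>2 * m0"
      using m0 assms by (simp add: field_simps)
    moreover have "e\<^sup>2 * m0 \<le> e\<^sup>2 * (2 * m + 1)"
      using that by (intro mult_left_mono) auto
    ultimately show False by linarith
  qed
  then show ?thesis by blast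
qed

lemma card_subsets_card_window:
  "card {A \<in> Pow {..<n}. l \<le> card A \<and> card A < l + c} \<le> c * (n choose (n div 2))"
proof -
  have "{A \<in> Pow {..<n}. l \<le> card A \<and> card A < l + c} = (\<Union>k\<in>{l..<l + c}. {A. A \<subseteq> {..<n} \<and> card A = k})"
    by auto
  also have "card \<dots> \<le> (\<Sum>k\<in>{l..<l + c}. card {A. A \<subseteq> {..<n} \<and> card A = k})"
    by (rule card_UN_le) simp
  also have "\<dots> \<le> (\<Sum>k\<in>{l..<l + c}. n choose (n div 2))"
    by (intro sum_mono) (simp add: n_subsets binomial_maximum)
  finally show ?thesis by simp
qed

text \<open>Keeping \<open>R\<close> inside \<open>a\<close> and complementing it outside
  \<open>a\<close> is injective. It turns the surplus of \<open>a \<inter> R\<close> over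
  \<open>R - a\<close>, which is at least 0 and less than \<open>t\<close>, into a size within a
  window of \<open>t\<close> consecutive values.\<close>

lemma card_balanced_subsets:
  assumes a: "a \<subseteq> {..<n}"
  shows "card {R \<in> Pow {..<n}. card R \<le> 2 * card (a \<inter> R) \<and> 2 * card (a \<inter> R) < card R + t}
    \<le> t * (n choose (n div 2))" (is "card ?W \<le> _")
proof -
  let ?q = "\<lambda>R. (a \<inter> R) \<union> (({..<n} - a) - R)"
  have "inj_on ?q ?W"
  proof (rule inj_on_inverseI)
    show "?q (?q R) = R" if "R \<in> ?W" for R using that a by auto
  qed
  moreover have "?q ` ?W \<subseteq> {A \<in> Pow {..<n}. card ({..<n} - a) \<le> card A \<and> card A < card ({..<n} - a) + t}"
  proof (rule image_subsetI)
    fix R assume R: "R \<in> ?W"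
    then have fin: "finite R" "finite a" using a finite_subset by auto
    have c1: "card R = card (a \<inter> R) + card (R - a)"
      using fin card_Int_Diff[of R a] by (simp add: Int_commute)
    have c2: "card ({..<n} - a) = card (R - a) + card (({..<n} - a) - R)"
    proof -
      have "({..<n} - a) \<inter> R = R - a" using R by auto
      then show ?thesis using card_Int_Diff[of "{..<n} - a" R] by simp
    qed
    have c3: "card (?q R) = card (a \<inter> R) + card (({..<n} - a) - R)"
      using fin by (intro card_Un_disjoint) auto
    have "?q R \<subseteq> {..<n}" using a by auto
    then show "?q R \<in> {A \<in> Pow {..<n}. card ({..<n} - a) \<le> card A \<and> card A < card ({..<n} - a) + t}"
      using R c1 c2 c3 by simp
  qed
  ultimately have "card ?W \<le> card {A \<in> Pow {..<n}. card ({..<n} - a) \<le> card A \<and> card A < card ({..<n} - a) + t}"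
    by (intro card_inj_on_le) auto
  also have "\<dots> \<le> t * (n choose (n div 2))" by (rule card_subsets_card_window)
  finally show ?thesis .
qed

text \<open>Closure under single, hence under finitely many, insertions. It is weaker than closure
  under supersets, but an extremal family acquires it by deleting a null set, because there are only
  countably many finite sets to insert.\<close>

definition insert_closed :: "nat set set \<Rightarrow> bool" where
  "insert_closed F \<longleftrightarrow> (\<forall>A\<in>F. \<forall>i. insert i A \<in> F)"

text \<open>The measure of this family is the influence of coordinate \<open>i\<close>. Membership
  of \<open>A\<close> does not depend on whether \<open>i \<in> A\<close>.\<close>

definition pivotal :: "nat \<Rightarrow> nat set set \<Rightarrow> nat set set" where
  "pivotal i F = {A. (insert i A \<in> F) \<noteq> (A - {i} \<in> F)}"

lemma insert_closed_remove: "insert_closed F \<Longrightarrow> A - {i} \<in> F \<Longrightarrow> insert i A \<in> F"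
  unfolding insert_closed_def by (metis insert_Diff_single)

lemma at_least_insert_cong:
  assumes "i \<notin> X" "j \<notin> X" shows "at_least t (insert i X) \<longleftrightarrow> at_least t (insert j X)"
  using assms by (cases "finite X") (auto simp: at_least_def)

text \<open>The shift of \<open>k\<close> to \<open>j\<close>. Two sets that differ by exchanging
  \<open>j\<close> and \<open>k\<close> form a pair; the one with \<open>j\<close> is kept if either
  is in \<open>F\<close>, the one with \<open>k\<close> if both are. As a membership condition
  instead of an image it is visibly measurable.\<close>

definition compress :: "nat \<Rightarrow> nat \<Rightarrow> nat set set \<Rightarrow> nat set set" where
  "compress j k F = {A. if j \<in> A \<longleftrightarrow> k \<in> A then A \<in> F
     else if j \<in> A then A \<in> F \<or> insert k (A - {j}) \<in> F
     else A \<in> F \<and> insert j (A - {k}) \<in> F}"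

lemma compress_mono: "F \<subseteq> G \<Longrightarrow> compress j k F \<subseteq> compress j k G"
  unfolding compress_def by (auto split: if_splits)

lemma compress_not_mem:
  assumes "A \<in> compress j k F" "A \<notin> F"
  shows "j \<in> A" "k \<notin> A" "insert k (A - {j}) \<in> F"
  using assms by (auto simp: compress_def split: if_splits)

text \<open>A new member \<open>A\<close> stems from \<open>A' \<in> F\<close> with \<open>k\<close>
  in place of \<open>j\<close>, and \<open>A \<inter> B\<close> is compared with
  \<open>A' \<inter> B\<close>. Only a \<open>B\<close> containing \<open>k\<close> but not
  \<open>j\<close> could lose an element.\<close>

lemma t_intersecting_compress:
  assumes F: "t_intersecting t F" and jk: "j \<noteq> k"
  shows "t_intersecting t (compress j k F)"
proof -
  have F': "at_least t (A \<inter> B)" if "A \<in> F" "B \<in> F" for A B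
    using F that by (simp add: t_intersecting_at_least)
  have one: "at_least t (A \<inter> B)" if A: "A \<in> compress j k F" "A \<notin> F" and B: "B \<in> compress j k F" "B \<in> F" for A B
  proof -
    define A' where "A' = insert k (A - {j})"
    have A': "A' \<in> F" "j \<in> A" "k \<notin> A" using compress_not_mem[OF A] by (auto simp: A'_def)
    consider "j \<in> B \<longleftrightarrow> k \<in> B" | "j \<in> B" "k \<notin> B" | "j \<notin> B" "k \<in> B" by auto
    then show ?thesis
    proof cases
      case 1
      show ?thesis
      proof (cases "j \<in> B")
        case True
        then have "A' \<inter> B = insert k (A \<inter> B - {j})" "A \<inter> B = insert j (A \<inter> B - {j})"
          using 1 A' jk by (auto simp: A'_def)
        then show ?thesis
          using F'[OF A'(1) B(2)] at_least_insert_cong[of k "A \<inter> B - {j}" j t] A' by auto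
      next
        case False
        then have "A' \<inter> B = A \<inter> B" using 1 A' by (auto simp: A'_def)
        then show ?thesis using F'[OF A'(1) B(2)] by simp
      qed
    next
      case 2
      then have "A' \<inter> B \<subseteq> A \<inter> B" by (auto simp: A'_def)
      then show ?thesis using F'[OF A'(1) B(2)] at_least_mono by blast
    next
      case 3
      \<comment> \<open>Such a \<open>B\<close> survives the compression only if its own shift is in
        \<open>F\<close>, and \<open>A'\<close> meets that shift exactly in
        \<open>A \<inter> B\<close>.\<close>
      then have "insert j (B - {k}) \<in> F" using B by (simp add: compress_def)
      moreover have "A' \<inter> insert j (B - {k}) = A \<inter> B" using 3 A' jk by (auto simp: A'_def)
      ultimately show ?thesis using F'[OF A'(1)] by metis
    qed
  qed
  have two: "at_least t (A \<inter> B)" if A: "A \<in> compress j k F" "A \<notin> F" and B: "B \<in> compress j k F" "B \<notin> F" for A B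
  proof -
    have "insert k (A - {j}) \<inter> insert k (B - {j}) = insert k (A \<inter> B - {j})"
      "A \<inter> B = insert j (A \<inter> B - {j})"
      using compress_not_mem[OF A] compress_not_mem[OF B] by auto
    then show ?thesis
      using F'[OF compress_not_mem(3)[OF A] compress_not_mem(3)[OF B]]
        at_least_insert_cong[of k "A \<inter> B - {j}" j t] compress_not_mem[OF A] by auto
  qed
  show ?thesis
    unfolding t_intersecting_at_least
    using F' one two by (metis Int_commute)
qed

lemma insert_closed_compress:
  assumes "insert_closed F" "j \<noteq> k"
  shows "insert_closed (compress j k F)"
  unfolding insert_closed_def
proof (intro ballI allI)
  fix A i assume A: "A \<in> compress j k F"
  have up: "insert l B \<in> F" if "B \<in> F" for B l using assms(1) that by (simp add: insert_closed_def)
  have e: "insert k (insert i A - {j}) = insert i (insert k (A - {j}))"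
    "insert j (insert i A - {k}) = insert i (insert j (A - {k}))" if "i \<noteq> j" "i \<noteq> k"
    using that by auto
  consider "i \<noteq> j" "i \<noteq> k" | "i \<in> A" | "i = j" "j \<notin> A" | "i = k" "k \<notin> A" by blast
  then show "insert i A \<in> compress j k F"
  proof cases
    case 1
    then show ?thesis using A assms(2) unfolding compress_def mem_Collect_eq e[OF 1]
      by (auto split: if_splits intro: up)
  next
    case 2
    then show ?thesis using A by (simp add: insert_absorb)
  next
    case 3
    then have "A \<in> F" using A by (auto simp: compress_def split: if_splits)
    then show ?thesis using 3 up by (simp add: compress_def)
  next
    case 4
    show ?thesis
    proof (cases "j \<in> A")
      case True
      then have "insert j (insert k (A - {j})) = insert k A" by auto
      then have "insert k A \<in> F"
        using A 4 True up[of "insert k (A - {j})" j] up[of A k] by (auto simp: compress_def)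
      then show ?thesis using True 4 by (simp add: compress_def)
    next
      case False
      then have "A \<in> F" using A 4 by (simp add: compress_def)
      then show ?thesis using False 4 up assms(2) by (simp add: compress_def)
    qed
  qed
qed

text \<open>Together with \<open>compress_remove\<close>: compression commutes with fixing a third
  coordinate, which is how influences at that coordinate are controlled.\<close>

lemma compress_insert: "i \<noteq> j \<Longrightarrow> i \<noteq> k \<Longrightarrow> {A. insert i A \<in> compress j k F} = compress j k {A. insert i A \<in> F}"
proof -
  assume i: "i \<noteq> j" "i \<noteq> k"
  then have "insert k (insert i A - {j}) = insert i (insert k (A - {j}))"
    "insert j (insert i A - {k}) = insert i (insert j (A - {k}))" for A by auto
  then show ?thesis using i by (simp add: compress_def)
qed

lemma compress_remove: "i \<noteq> j \<Longrightarrow> i \<noteq> k \<Longrightarrow> {A. A - {i} \<in> compress j k F} = compress j k {A. A - {i} \<in> F}"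
proof -
  assume i: "i \<noteq> j" "i \<noteq> k"
  then have "insert k (A - {i} - {j}) = insert k (A - {j}) - {i}"
    "insert j (A - {i} - {k}) = insert j (A - {k}) - {i}" for A by auto
  then show ?thesis using i by (simp add: compress_def)
qed

lemma determined_compress:
  assumes D: "determined m D" and jk: "j < m" "k < m"
  shows "determined m (compress j k D)"
proof -
  have D': "A \<in> D \<longleftrightarrow> B \<in> D" if "A \<inter> {..<m} = B \<inter> {..<m}" for A B
    using D that unfolding determined_def by metis
  have "insert k (A \<inter> {..<m} - {j}) \<in> D \<longleftrightarrow> insert k (A - {j}) \<in> D"
    "insert j (A \<inter> {..<m} - {k}) \<in> D \<longleftrightarrow> insert j (A - {k}) \<in> D"
    "A \<inter> {..<m} \<in> D \<longleftrightarrow> A \<in> D" for A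
    by (rule D'; use jk in auto)+
  then show ?thesis
    using jk by (simp add: determined_def compress_def)
qed

definition compressed :: "nat \<Rightarrow> nat \<Rightarrow> nat set set \<Rightarrow> bool" where
  "compressed j k F \<longleftrightarrow> (\<forall>A\<in>F. k \<in> A \<longrightarrow> j \<notin> A \<longrightarrow> insert j (A - {k}) \<in> F)"

lemma compressed_compress: "j \<noteq> k \<Longrightarrow> compressed j k (compress j k F)"
  by (auto simp: compressed_def compress_def)

text \<open>Compression neither adds a set containing \<open>k\<close> nor removes one without
  \<open>k\<close>. So successive compressions of \<open>k\<close> towards several targets do not
  undo each other.\<close>

lemma compressed_compress_other:
  assumes "compressed i k F" "j \<noteq> k" "i \<noteq> k"
  shows "compressed i k (compress j k F)"
  unfolding compressed_def
proof (intro ballI impI)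
  fix A assume A: "A \<in> compress j k F" "k \<in> A" "i \<notin> A"
  then have "A \<in> F" by (auto simp: compress_def split: if_splits)
  then have "insert i (A - {k}) \<in> F" using A assms(1) by (simp add: compressed_def)
  then show "insert i (A - {k}) \<in> compress j k F" using assms(3) by (simp add: compress_def)
qed

section \<open>Measure, influence and distance under compression\<close>

context biased_cube
begin

lemma pivotal_events: "F \<in> events \<Longrightarrow> pivotal i F \<in> events"
proof -
  assume "F \<in> events"
  then have "sym_diff {A. insert i A \<in> F} {A. A - {i} \<in> F} \<in> events"
    by (intro sets.Un sets.Diff sets_insert_cube sets_remove_cube)
  moreover have "pivotal i F = sym_diff {A. insert i A \<in> F} {A. A - {i} \<in> F}"
    by (auto simp: pivotal_def)
  ultimately show ?thesis by simp
qed

lemma prob_pivotal_insert_closed: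
  assumes "F \<in> events" "insert_closed F"
  shows "prob (pivotal i F) = prob {A. insert i A \<in> F} - prob {A. A - {i} \<in> F}"
proof -
  have "pivotal i F = {A. insert i A \<in> F} - {A. A - {i} \<in> F}"
    using insert_closed_remove[OF assms(2)] by (auto simp: pivotal_def)
  moreover have "{A. A - {i} \<in> F} \<subseteq> {A. insert i A \<in> F}"
    using insert_closed_remove[OF assms(2)] by auto
  ultimately show ?thesis
    using assms(1) by (simp add: finite_measure_Diff sets_insert_cube sets_remove_cube)
qed

lemma prob_Un_add_Int:
  "A \<in> events \<Longrightarrow> B \<in> events \<Longrightarrow> prob (A \<union> B) + prob (A \<inter> B) = prob A + prob B"
  using finite_measure_Union'[of A B] finite_measure_Diff'[of B A] by (simp add: Int_commute)

lemma compress_events: 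
  assumes "F \<in> events" shows "compress j k F \<in> events"
proof -
  have "{A. insert k (A - {j}) \<in> F} \<in> events" "{A. insert j (A - {k}) \<in> F} \<in> events"
    using sets_remove_cube[OF sets_insert_cube[OF assms]] by simp_all
  then have "(({A. j \<in> A} \<inter> {A. k \<in> A}) \<inter> F) \<union> (- {A. j \<in> A} \<inter> - {A. k \<in> A} \<inter> F)
    \<union> ({A. j \<in> A} \<inter> - {A. k \<in> A} \<inter> (F \<union> {A. insert k (A - {j}) \<in> F}))
    \<union> (- {A. j \<in> A} \<inter> {A. k \<in> A} \<inter> F \<inter> {A. insert j (A - {k}) \<in> F}) \<in> events"
    using assms by (intro sets.Un sets.Int events_complement sets_cube_member)
  also have "(({A. j \<in> A} \<inter> {A. k \<in> A}) \<inter> F) \<union> (- {A. j \<in> A} \<inter> - {A. k \<in> A} \<inter> F)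
    \<union> ({A. j \<in> A} \<inter> - {A. k \<in> A} \<inter> (F \<union> {A. insert k (A - {j}) \<in> F}))
    \<union> (- {A. j \<in> A} \<inter> {A. k \<in> A} \<inter> F \<inter> {A. insert j (A - {k}) \<in> F}) = compress j k F"
    by (auto simp: compress_def)
  finally show ?thesis .
qed

text \<open>Of the four sections at \<open>j\<close> and \<open>k\<close>, only the two mixed ones
  change: they become their union and their intersection, and both carry the weight
  \<open>p * (1 - p)\<close>.\<close>

lemma prob_compress:
  assumes F: "F \<in> events" and jk: "j \<noteq> k"
  shows "prob (compress j k F) = prob F"
proof -
  let ?s = "\<lambda>F. {A. insert j (insert k A) \<in> F}" and ?n = "\<lambda>F. {A. A - {j} - {k} \<in> F}"
  let ?j = "\<lambda>F. {A. insert j (A - {k}) \<in> F}" and ?k = "\<lambda>F. {A. insert k (A - {j}) \<in> F}"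
  have re: "prob G = p * p * prob (?s G) + p * (1 - p) * (prob (?j G) + prob (?k G))
      + (1 - p) * (1 - p) * prob (?n G)" if G: "G \<in> events" for G
  proof -
    have 1: "prob {A. insert j A \<in> G} = p * prob (?s G) + (1 - p) * prob (?j G)"
      using resample[OF sets_insert_cube[OF G], of j k] by simp
    have "insert k A - {j} = insert k (A - {j})" for A using jk by auto
    then have 2: "prob {A. A - {j} \<in> G} = p * prob (?k G) + (1 - p) * prob (?n G)"
      using resample[OF sets_remove_cube[OF G], of j k]
      by (simp add: Diff_insert2[symmetric] insert_commute)
    show ?thesis
      by (subst resample[OF G, of j], subst 1, subst 2) (simp add: algebra_simps)
  qed
  have ev: "?j F \<in> events" "?k F \<in> events"
    using sets_remove_cube[OF sets_insert_cube[OF F]] by simp_all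
  have [simp]: "insert j (A - {k}) - {j} = A - {j} - {k}" "insert k (A - {j}) - {k} = A - {j} - {k}" for A
    using jk by auto
  have [simp]: "insert k (A - {j} - {k}) = insert k (A - {j})" "insert j (A - {j} - {k}) = insert j (A - {k})" for A
    using jk by auto
  have "?s (compress j k F) = ?s F" "?n (compress j k F) = ?n F"
    "?j (compress j k F) = ?j F \<union> ?k F" "?k (compress j k F) = ?j F \<inter> ?k F"
    using jk by (auto simp: compress_def)
  then have "prob (compress j k F) = p * p * prob (?s F) + p * (1 - p) * (prob (?j F \<union> ?k F) + prob (?j F \<inter> ?k F))
      + (1 - p) * (1 - p) * prob (?n F)"
    by (subst re[OF compress_events[OF F]]) simp
  also have "\<dots> = prob F" unfolding prob_Un_add_Int[OF ev] by (rule re[OF F, symmetric])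
  finally show ?thesis .
qed

lemma prob_pivotal_compress:
  assumes F: "F \<in> events" "insert_closed F" and "j \<noteq> k" "i \<noteq> j" "i \<noteq> k"
  shows "prob (pivotal i (compress j k F)) = prob (pivotal i F)"
  unfolding prob_pivotal_insert_closed[OF F]
    prob_pivotal_insert_closed[OF compress_events[OF F(1)] insert_closed_compress[OF F(2) \<open>j \<noteq> k\<close>]]
    compress_insert[OF assms(4,5)] compress_remove[OF assms(4,5)]
  by (simp only: prob_compress[OF _ \<open>j \<noteq> k\<close>] F sets_insert_cube sets_remove_cube)

lemma prob_sym_diff:
  assumes "F \<in> events" "D \<in> events"
  shows "prob (sym_diff F D) = prob F + prob D - 2 * prob (F \<inter> D)"
proof -
  have "prob (sym_diff F D) = prob (F - D) + prob (D - F)"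
    using assms by (intro finite_measure_Union) auto
  then show ?thesis
    using assms finite_measure_Diff'[of F D] finite_measure_Diff'[of D F] by (simp add: Int_commute)
qed

text \<open>Compression preserves both measures and is monotone, so the intersection of the two
  families can only gain measure.\<close>

lemma prob_sym_diff_compress_le:
  assumes "F \<in> events" "D \<in> events" "j \<noteq> k"
  shows "prob (sym_diff (compress j k F) (compress j k D)) \<le> prob (sym_diff F D)"
proof -
  have "prob (F \<inter> D) = prob (compress j k (F \<inter> D))" using assms by (simp add: prob_compress)
  also have "\<dots> \<le> prob (compress j k F \<inter> compress j k D)"
    using assms compress_mono[of "F \<inter> D" F j k] compress_mono[of "F \<inter> D" D j k]
    by (intro finite_measure_mono sets.Int compress_events) auto
  finally show ?thesis
    using assms by (simp add: prob_sym_diff compress_events prob_compress)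
qed

section \<open>Influences of compressed extremal families\<close>


text \<open>Not all of \<open>D = pivotal k F\<close> can be added to \<open>{A. A - {k} \<in> F}\<close>, but the members of \<open>D\<close> with \<open>2 * card (A \<inter> R) < card R\<close> can, because two of them do not cover \<open>R\<close>, and so
  can those with \<open>2 * card (A \<inter> R) \<ge> card R + t\<close>.  Averaging over \<open>R\<close> shows that one of these
  additions would increase the measure.\<close>

lemma extremal_compressed_pivotal_null:
  assumes F: "F \<in> events" "t_intersecting t F" "insert_closed F"
    and extremal: "\<And>G. G \<in> events \<Longrightarrow> t_intersecting t G \<Longrightarrow> prob G \<le> prob F"
    and nk: "n \<le> k" and sh: "\<And>j. j < n \<Longrightarrow> compressed j k F"
    and t: "1 \<le> t" and large: "t * real (n choose (n div 2)) < (1 - 2 * p) * 2 ^ n"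
  shows "prob (pivotal k F) = 0"
proof -
  define D where "D = pivotal k F"
  define F0 where "F0 = {A. A - {k} \<in> F}"
  define L where "L R = {A. 2 * card (A \<inter> R) < card R}" for R :: "nat set"
  define U where "U R = {A. card R + t \<le> 2 * card (A \<inter> R)}" for R :: "nat set"
  define W where "W R = {A. card R \<le> 2 * card (A \<inter> R) \<and> 2 * card (A \<inter> R) < card R + t}" for R :: "nat set"
  have F': "at_least t (A \<inter> B)" if "A \<in> F" "B \<in> F" for A B
    using F(2) that by (simp add: t_intersecting_at_least)
  have Dmem: "insert k A \<in> F" "A - {k} \<notin> F" if "A \<in> D" for A
    using that insert_closed_remove[OF F(3), of A k] by (auto simp: D_def pivotal_def)
  have ev: "D \<in> events" "F0 \<in> events"
    using F(1) by (simp_all add: D_def F0_def pivotal_events sets_remove_cube)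
  have evR: "L R \<in> events" "U R \<in> events" "W R \<in> events" if "R \<subseteq> {..<n}" for R
  proof -
    have "finite R" using that finite_subset by auto
    then show "L R \<in> events" "U R \<in> events" "W R \<in> events"
      using sets_cube_finite_pred[of R "\<lambda>B. 2 * card B < card R" p]
        sets_cube_finite_pred[of R "\<lambda>B. card R + t \<le> 2 * card B" p]
        sets_cube_finite_pred[of R "\<lambda>B. card R \<le> 2 * card B \<and> 2 * card B < card R + t" p]
      by (simp_all add: L_def U_def W_def)
  qed
  have disj: "F0 \<inter> D = {}" using Dmem by (auto simp: F0_def)
  have pF: "prob F = prob F0 + p * prob D"
  proof -
    have "{A. insert k A \<in> F} = F0 \<union> D"
      using insert_closed_remove[OF F(3)] by (intro set_eqI) (simp add: F0_def D_def pivotal_def, blast)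
    then have "prob {A. insert k A \<in> F} = prob F0 + prob D"
      using disj ev by (simp add: finite_measure_Union)
    then show ?thesis
      using resample[OF F(1), of k] by (simp add: F0_def algebra_simps)
  qed
  \<comment> \<open>In \<open>prob F\<close> the part \<open>D\<close> counts only with the factor
    \<open>p\<close>. If \<open>D \<inter> X\<close> is t-intersecting, then so is
    \<open>F0 \<union> D \<inter> X\<close>, where \<open>D \<inter> X\<close> counts in full;
    extremality limits it.\<close>
  have add: "prob (D \<inter> X) \<le> p * prob D"
    if X: "X \<in> events" and XX: "\<And>A B. A \<in> D \<inter> X \<Longrightarrow> B \<in> D \<inter> X \<Longrightarrow> at_least t (A \<inter> B)" for X
  proof -
    have 1: "at_least t (A \<inter> B)" if A: "A \<in> F0" and B: "B \<in> F0 \<union> D \<inter> X" for A B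
    proof -
      have "A - {k} \<in> F" using A by (simp add: F0_def)
      moreover have "insert k B \<in> F"
        using B Dmem insert_closed_remove[OF F(3), of B k] by (auto simp: F0_def)
      ultimately have "at_least t ((A - {k}) \<inter> insert k B)" using F' by blast
      then show ?thesis by (rule at_least_mono) auto
    qed
    have "t_intersecting t (F0 \<union> D \<inter> X)"
      unfolding t_intersecting_at_least
    proof (intro ballI)
      fix A B assume "A \<in> F0 \<union> D \<inter> X" "B \<in> F0 \<union> D \<inter> X"
      then show "at_least t (A \<inter> B)" using 1[of A B] 1[of B A] XX[of A B] by (auto simp: Int_commute)
    qed
    then have "prob (F0 \<union> D \<inter> X) \<le> prob F" using ev X by (intro extremal) auto
    moreover have "prob (F0 \<union> D \<inter> X) = prob F0 + prob (D \<inter> X)"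
      using ev X disj by (intro finite_measure_Union) auto
    ultimately show ?thesis using pF by simp
  qed
  have addL: "prob (D \<inter> L R) \<le> p * prob D" if R: "R \<subseteq> {..<n}" for R
  proof (rule add)
    fix A B assume A: "A \<in> D \<inter> L R" and B: "B \<in> D \<inter> L R"
    have fR: "finite R" using R finite_subset by auto
    have "card ((A \<inter> R) \<union> (B \<inter> R)) < card R"
      using A B card_Un_le[of "A \<inter> R" "B \<inter> R"] by (simp add: L_def)
    then have "\<not> R \<subseteq> (A \<inter> R) \<union> (B \<inter> R)"
      using card_mono[of "(A \<inter> R) \<union> (B \<inter> R)" R] fR by auto
    \<comment> \<open>In \<open>insert k A\<close> the point \<open>k\<close> can be replaced by
      this \<open>j\<close>, which lies outside \<open>B\<close>; the result shares with
      \<open>insert k B\<close> only elements of \<open>A \<inter> B\<close>.\<close>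
    then obtain j where j: "j \<in> R" "j \<notin> A" "j \<notin> B" by auto
    then have jn: "j < n" "j \<noteq> k" using R nk by auto
    have "insert j (insert k A - {k}) \<in> F"
      using sh[OF jn(1), unfolded compressed_def, rule_format, OF Dmem(1)[of A]] A j jn by blast
    moreover have "insert k B \<in> F" using Dmem B by simp
    ultimately have "at_least t (insert j (insert k A - {k}) \<inter> insert k B)" using F' by blast
    then show "at_least t (A \<inter> B)" by (rule at_least_mono) (use j jn in auto)
  qed (use evR R in simp)
  have addU: "prob (D \<inter> U R) \<le> p * prob D" if R: "R \<subseteq> {..<n}" for R
  proof (rule add)
    fix A B assume A: "A \<in> D \<inter> U R" and B: "B \<in> D \<inter> U R"
    have fR: "finite R" using R finite_subset by auto
    have "card ((A \<inter> R) \<union> (B \<inter> R)) \<le> card R" by (intro card_mono fR) auto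
    moreover have "card (A \<inter> R) + card (B \<inter> R) = card ((A \<inter> R) \<union> (B \<inter> R)) + card ((A \<inter> R) \<inter> (B \<inter> R))"
      using fR by (intro card_Un_Int) auto
    ultimately have "t \<le> card ((A \<inter> R) \<inter> (B \<inter> R))" using A B by (simp add: U_def)
    then have "at_least t ((A \<inter> R) \<inter> (B \<inter> R))" by (simp add: at_least_def)
    then show "at_least t (A \<inter> B)" by (rule at_least_mono) auto
  qed (use evR R in simp)
  \<comment> \<open>For every \<open>R\<close> the nearly balanced part \<open>W R\<close> thus
    carries at least the fraction 1 - 2 * p of \<open>D\<close>; averaged over \<open>R\<close> this
    will contradict the count of balanced sets.\<close>
  have low: "prob D - prob (D \<inter> W R) \<le> 2 * p * prob D" if R: "R \<subseteq> {..<n}" for R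
  proof -
    have "D \<subseteq> (D \<inter> L R \<union> D \<inter> U R) \<union> D \<inter> W R" by (auto simp: L_def U_def W_def)
    then have "prob D \<le> prob ((D \<inter> L R \<union> D \<inter> U R) \<union> D \<inter> W R)"
      using ev evR[OF R] by (intro finite_measure_mono) auto
    also have "\<dots> \<le> prob (D \<inter> L R \<union> D \<inter> U R) + prob (D \<inter> W R)"
      using ev evR[OF R] by (intro measure_Un_le) auto
    also have "prob (D \<inter> L R \<union> D \<inter> U R) \<le> prob (D \<inter> L R) + prob (D \<inter> U R)"
      using ev evR[OF R] by (intro measure_Un_le) auto
    finally show ?thesis using addL[OF R] addU[OF R] by simp
  qed
  define E where "E a = D \<inter> {A. A \<inter> {..<n} = a}" for a
  have evE: "E a \<in> events" for a using ev unfolding E_def by (intro sets.Int sets_cube_finite_subset) auto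
  have disE: "disjoint_family_on E T" for T by (auto simp: disjoint_family_on_def E_def)
  have sumE: "prob (\<Union>a\<in>T. E a) = (\<Sum>a\<in>T. prob (E a))" if "finite T" for T
    using that evE disE by (intro finite_measure_finite_Union) auto
  let ?C = "n choose (n div 2)"
  \<comment> \<open>Double counting: \<open>D\<close> is split by the trace \<open>a\<close> on the
    first \<open>n\<close> coordinates, and for each \<open>a\<close> few \<open>R\<close> are
    balanced.\<close>
  have "(\<Sum>R\<in>Pow {..<n}. prob (D \<inter> W R)) = (\<Sum>R\<in>Pow {..<n}. \<Sum>a\<in>Pow {..<n}. if a \<in> W R then prob (E a) else 0)"
  proof (rule sum.cong[OF refl])
    fix R assume "R \<in> Pow {..<n}"
    then have "A \<inter> {..<n} \<inter> R = A \<inter> R" for A by auto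
    then have "A \<inter> {..<n} \<in> W R \<longleftrightarrow> A \<in> W R" for A by (simp add: W_def)
    then have "D \<inter> W R = (\<Union>a\<in>{a\<in>Pow {..<n}. a \<in> W R}. E a)" by (auto simp: E_def)
    then have "prob (D \<inter> W R) = (\<Sum>a\<in>{a\<in>Pow {..<n}. a \<in> W R}. prob (E a))"
      by (simp only:) (intro sumE, simp)
    then show "prob (D \<inter> W R) = (\<Sum>a\<in>Pow {..<n}. if a \<in> W R then prob (E a) else 0)"
      by (simp only: sum.inter_filter finite_Pow_iff finite_lessThan)
  qed
  also have "\<dots> = (\<Sum>a\<in>Pow {..<n}. \<Sum>R\<in>Pow {..<n}. if a \<in> W R then prob (E a) else 0)"
    by (rule sum.swap)
  also have "\<dots> = (\<Sum>a\<in>Pow {..<n}. real (card {R\<in>Pow {..<n}. a \<in> W R}) * prob (E a))"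
    by (intro sum.cong refl) (simp add: sum.inter_filter[symmetric] del: Pow_iff)
  also have "\<dots> \<le> (\<Sum>a\<in>Pow {..<n}. (t * real ?C) * prob (E a))"
  proof (intro sum_mono mult_right_mono measure_nonneg)
    fix a assume "a \<in> Pow {..<n}"
    then have "card {R\<in>Pow {..<n}. a \<in> W R} \<le> t * ?C"
      using card_balanced_subsets[of a n t] by (simp add: W_def)
    then show "real (card {R\<in>Pow {..<n}. a \<in> W R}) \<le> t * real ?C"
      by (metis of_nat_le_iff of_nat_mult)
  qed
  also have "\<dots> = (t * real ?C) * prob D"
  proof -
    have "D = (\<Union>a\<in>Pow {..<n}. E a)" by (auto simp: E_def)
    then have "prob D = (\<Sum>a\<in>Pow {..<n}. prob (E a))" using sumE[of "Pow {..<n}"] by simp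
    then show ?thesis by (simp add: sum_distrib_left)
  qed
  finally have up: "(\<Sum>R\<in>Pow {..<n}. prob (D \<inter> W R)) \<le> (t * real ?C) * prob D" .
  have "(\<Sum>R\<in>Pow {..<n}. prob D - prob (D \<inter> W R)) \<le> (\<Sum>R\<in>Pow {..<n}. 2 * p * prob D)"
    by (intro sum_mono low) auto
  then have "2 ^ n * prob D - (t * real ?C) * prob D \<le> 2 ^ n * (2 * p * prob D)"
    using up by (simp add: sum_subtractf card_Pow)
  then have "((1 - 2 * p) * 2 ^ n - t * real ?C) * prob D \<le> 0" by (simp add: algebra_simps)
  then have "prob D \<le> 0" using large by (simp add: mult_le_0_iff)
  then have "prob D = 0" by (intro antisym measure_nonneg)
  then show ?thesis by (simp add: D_def)
qed

text \<open>Up to a null set \<open>F\<close> ignores coordinate \<open>n\<close>, so the weighted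
  average of its distances to the two sections of \<open>D\<close> is at most its distance to
  \<open>D\<close>. One section is therefore at least as close as \<open>D\<close>.\<close>

lemma eliminate_coordinate:
  assumes F: "F \<in> events" "prob (pivotal n F) = 0" and D: "determined (Suc n) D"
  shows "\<exists>D'. determined n D' \<and> prob (sym_diff F D') \<le> prob (sym_diff F D)"
proof -
  define D1 D0 where "D1 = {A. insert n A \<in> D}" and "D0 = {A. A - {n} \<in> D}"
  have D': "A \<in> D \<longleftrightarrow> B \<in> D" if "A \<inter> {..<Suc n} = B \<inter> {..<Suc n}" for A B
    using D that unfolding determined_def by metis
  have det: "determined n D1" "determined n D0"
    unfolding determined_def D1_def D0_def mem_Collect_eq by (intro allI D'; auto)+
  have ev: "D \<in> events" "D1 \<in> events" "D0 \<in> events" "pivotal n F \<in> events"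
    using det D F determined_events pivotal_events by auto
  define G where "G = sym_diff F D"
  have evG: "G \<in> events" using F ev by (auto simp: G_def)
  have x: "insert n A = A \<or> A - {n} = A" for A :: "nat set" by auto
  have s1: "A \<in> {A. insert n A \<in> G} \<union> pivotal n F" if "A \<in> sym_diff F D1" for A
    using x[of A] that by (simp only: Un_iff Diff_iff mem_Collect_eq G_def D1_def pivotal_def) metis
  have s0: "A \<in> {A. A - {n} \<in> G} \<union> pivotal n F" if "A \<in> sym_diff F D0" for A
    using x[of A] that by (simp only: Un_iff Diff_iff mem_Collect_eq G_def D0_def pivotal_def) metis
  have "prob (sym_diff F D1) \<le> prob ({A. insert n A \<in> G} \<union> pivotal n F)"
    using F ev evG s1 by (intro finite_measure_mono subsetI sets.Un sets_insert_cube)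
  also have "\<dots> \<le> prob {A. insert n A \<in> G} + prob (pivotal n F)"
    using evG ev by (intro measure_Un_le sets_insert_cube)
  finally have 1: "prob (sym_diff F D1) \<le> prob {A. insert n A \<in> G}" using F by simp
  have "prob (sym_diff F D0) \<le> prob ({A. A - {n} \<in> G} \<union> pivotal n F)"
    using F ev evG s0 by (intro finite_measure_mono subsetI sets.Un sets_remove_cube)
  also have "\<dots> \<le> prob {A. A - {n} \<in> G} + prob (pivotal n F)"
    using evG ev by (intro measure_Un_le sets_remove_cube)
  finally have 0: "prob (sym_diff F D0) \<le> prob {A. A - {n} \<in> G}" using F by simp
  have "p * prob (sym_diff F D1) + (1 - p) * prob (sym_diff F D0) \<le> prob G"
    unfolding resample[OF evG, of n] using 0 1 p_nonneg p_le_1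
    by (intro add_mono mult_left_mono) auto
  moreover have "prob G = p * prob G + (1 - p) * prob G" by (simp add: algebra_simps)
  ultimately have "prob (sym_diff F D1) \<le> prob G \<or> prob (sym_diff F D0) \<le> prob G"
    using p_nonneg p_le_1 
    by (smt (verit) mult_left_mono mult_strict_left_mono)
  then show ?thesis using det unfolding G_def by blast
qed

lemma eliminate_coordinates:
  assumes F: "F \<in> events" and "n \<le> m" "\<And>i. n \<le> i \<Longrightarrow> i < m \<Longrightarrow> prob (pivotal i F) = 0"
    and D: "determined m D"
  shows "\<exists>D'. determined n D' \<and> prob (sym_diff F D') \<le> prob (sym_diff F D)"
  using assms(2-)
proof (induction m arbitrary: D rule: dec_induct)
  case base
  then show ?case by blast
next
  case (step m)
  obtain D1 where D1: "determined m D1" "prob (sym_diff F D1) \<le> prob (sym_diff F D)"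
    using eliminate_coordinate[OF F step(4) step(5)] step(1) by auto
  then obtain D' where "determined n D'" "prob (sym_diff F D') \<le> prob (sym_diff F D1)"
    using step by (metis less_SucI)
  then show ?case using D1 by (meson order_trans)
qed

lemma finite_determined: "finite {D. determined n D}"
proof (rule finite_imageD)
  show "finite ((\<lambda>D. D \<inter> Pow {..<n}) ` {D. determined n D})"
    by (rule finite_subset[of _ "Pow (Pow {..<n})"]) auto
  show "inj_on (\<lambda>D. D \<inter> Pow {..<n}) {D. determined n D}"
  proof (rule inj_onI)
    fix D D' assume D: "D \<in> {D. determined n D}" "D' \<in> {D. determined n D}"
      and e: "D \<inter> Pow {..<n} = D' \<inter> Pow {..<n}"
    have "C \<in> D \<longleftrightarrow> C \<in> D'" for C
    proof -
      have "C \<inter> {..<n} \<in> D \<inter> Pow {..<n} \<longleftrightarrow> C \<inter> {..<n} \<in> D' \<inter> Pow {..<n}" by (simp only: e)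
      then show ?thesis using D by (simp add: determined_def)
    qed
    then show "D = D'" by auto
  qed
qed

text \<open>Dropping coordinates turns arbitrarily good approximants into ones determined by
  \<open>n\<close>. There are only finitely many of those, so the infimum 0 of the distances is
  attained.\<close>

lemma pivotal_null_imp_determined:
  assumes F: "F \<in> events" and "\<And>i. n \<le> i \<Longrightarrow> prob (pivotal i F) = 0"
  shows "\<exists>D. determined n D \<and> prob (sym_diff F D) = 0"
proof -
  let ?V = "(\<lambda>D. prob (sym_diff F D)) ` {D. determined n D}"
  have V: "finite ?V" using finite_determined by blast
  have ne: "?V \<noteq> {}" by (auto simp: determined_def intro!: exI[of _ "{}"])
  have "Min ?V \<le> 0"
  proof (rule field_le_epsilon)
    fix e :: real assume "e > 0"
    then obtain m D where D: "determined m D" "prob (sym_diff F D) < e"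
      using events_approx[OF F] by blast
    have "determined (max n m) D" by (rule determined_mono[OF D(1)]) simp
    then obtain D' where "determined n D'" "prob (sym_diff F D') \<le> prob (sym_diff F D)"
      using eliminate_coordinates[OF F, of n "max n m" D] assms(2) by auto
    then show "Min ?V \<le> 0 + e" using D V
      by (smt (verit, best) Min_le image_eqI mem_Collect_eq)
  qed
  moreover have "Min ?V \<in> ?V" using V ne by (rule Min_in)
  ultimately show ?thesis by (auto simp: measure_le_0_iff)
qed

section \<open>Extremal families are determined by finitely many coordinates\<close>


lemma null_insert:
  assumes "0 < p" "X \<in> events" "prob X = 0" shows "prob {A. insert i A \<in> X} = 0"
proof -
  have "p * prob {A. insert i A \<in> X} + (1 - p) * prob {A. A - {i} \<in> X} = 0"
    using resample[OF assms(2), of i] assms(3) by simp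
  moreover have "0 \<le> p * prob {A. insert i A \<in> X}" "0 \<le> (1 - p) * prob {A. A - {i} \<in> X}"
    using p_nonneg p_le_1 by (auto intro: mult_nonneg_nonneg)
  ultimately show ?thesis using assms(1) by (simp only: add_nonneg_eq_0_iff mult_eq_0_iff) simp
qed

lemma null_remove:
  assumes "p < 1" "X \<in> events" "prob X = 0" shows "prob {A. A - {i} \<in> X} = 0"
proof -
  have "p * prob {A. insert i A \<in> X} + (1 - p) * prob {A. A - {i} \<in> X} = 0"
    using resample[OF assms(2), of i] assms(3) by simp
  moreover have "0 \<le> p * prob {A. insert i A \<in> X}" "0 \<le> (1 - p) * prob {A. A - {i} \<in> X}"
    using p_nonneg p_le_1 by (auto intro: mult_nonneg_nonneg)
  ultimately show ?thesis using assms(1) by (simp only: add_nonneg_eq_0_iff mult_eq_0_iff) simp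
qed

lemma union_events: "finite E \<Longrightarrow> X \<in> events \<Longrightarrow> {A. A \<union> E \<in> X} \<in> events"
proof (induction E arbitrary: X rule: finite_induct)
  case (insert i E)
  then show ?case using sets_insert_cube[OF insert.IH[OF insert.prems], of i] by simp
qed simp

lemma null_union: "finite E \<Longrightarrow> 0 < p \<Longrightarrow> X \<in> events \<Longrightarrow> prob X = 0 \<Longrightarrow> prob {A. A \<union> E \<in> X} = 0"
proof (induction E arbitrary: X rule: finite_induct)
  case (insert i E)
  show ?case
    using null_insert[OF insert.prems(1) union_events[OF insert.hyps(1) insert.prems(2)]
        insert.IH[OF insert.prems], of i] by simp
qed simp

lemma null_mono: "X \<subseteq> Y \<Longrightarrow> Y \<in> events \<Longrightarrow> prob Y = 0 \<Longrightarrow> prob X = 0"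
  using finite_measure_mono[of X Y] by (intro antisym measure_nonneg) simp

lemma null_Un: "X \<in> events \<Longrightarrow> Y \<in> events \<Longrightarrow> prob X = 0 \<Longrightarrow> prob Y = 0 \<Longrightarrow> prob (X \<union> Y) = 0"
  using measure_Un_le[of X "cube p" Y] by (intro antisym measure_nonneg) simp

definition extremal :: "nat \<Rightarrow> nat set set \<Rightarrow> bool" where
  "extremal t F \<longleftrightarrow> F \<in> events \<and> t_intersecting t F \<and>
    (\<forall>G\<in>events. t_intersecting t G \<longrightarrow> prob G \<le> prob F)"

text \<open>Let \<open>Z\<close> consist of the sets outside \<open>F\<close> that contain
  \<open>i\<close> and fall into \<open>F\<close> when \<open>i\<close> is removed. Every member of
  \<open>F \<union> Z\<close> contains a member of \<open>F\<close>, so this union is t-intersecting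
  and extremality makes \<open>Z\<close> null.\<close>

lemma extremal_almost_insert_closed:
  assumes p: "0 < p" and F: "extremal t F"
  shows "prob {A \<in> F. insert i A \<notin> F} = 0"
proof -
  have ev: "F \<in> events" using F by (simp add: extremal_def)
  define Z where "Z = {A. i \<in> A} \<inter> {A. A - {i} \<in> F} - F"
  define Y where "Y = {A. A - {i} \<in> F} - {A. insert i A \<in> F}"
  have evZ: "Z \<in> events" "Y \<in> events" unfolding Z_def Y_def
    by (intro sets.Diff sets.Int sets_cube_member sets_remove_cube sets_insert_cube ev)+
  have "\<exists>C\<in>F. C \<subseteq> A" if "A \<in> F \<union> Z" for A using that by (auto simp: Z_def)
  then have "t_intersecting t (F \<union> Z)"
    unfolding t_intersecting_at_least
  proof (intro ballI)
    fix A B assume "A \<in> F \<union> Z" "B \<in> F \<union> Z"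
    then obtain A' B' where "A' \<in> F" "A' \<subseteq> A" "B' \<in> F" "B' \<subseteq> B"
      using \<open>\<And>A. A \<in> F \<union> Z \<Longrightarrow> \<exists>C\<in>F. C \<subseteq> A\<close> by meson
    moreover from this have "at_least t (A' \<inter> B')"
      using F unfolding extremal_def t_intersecting_at_least by blast
    ultimately show "at_least t (A \<inter> B)" by (meson Int_mono at_least_mono)
  qed
  then have "prob (F \<union> Z) \<le> prob F" using F ev evZ by (simp add: extremal_def)
  moreover have "prob (F \<union> Z) = prob F + prob Z"
    using ev evZ by (intro finite_measure_Union) (auto simp: Z_def)
  ultimately have Z0: "prob Z = 0" by (intro antisym measure_nonneg) simp
  \<comment> \<open>The failures themselves do not contain \<open>i\<close>; pulling
    \<open>Z\<close> back along \<open>insert i\<close> reaches them, and preserves null sets since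
    \<open>p > 0\<close>.\<close>
  have "{A. insert i A \<in> Z} = Y" by (auto simp: Z_def Y_def)
  then have Y0: "prob Y = 0" using null_insert[OF p evZ(1) Z0, of i] by simp
  let ?V = "F - {A. insert i A \<in> F}"
  have "A \<in> Y" if "A \<in> ?V" for A
  proof -
    have "A - {i} = A" using that by (auto simp: insert_absorb)
    then show ?thesis using that by (simp add: Y_def)
  qed
  then have "prob ?V = 0" using null_mono[OF _ evZ(2) Y0, of ?V] by blast
  moreover have "{A \<in> F. insert i A \<notin> F} = ?V" by auto
  ultimately show ?thesis by simp
qed

text \<open>\<open>F'\<close> consists of those \<open>A\<close> all of whose finite enlargements
  lie in \<open>F\<close>. Each of the countably many finite sets excludes only a null set, and a
  subfamily stays t-intersecting.\<close>

lemma extremal_insert_closed_core: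
  assumes p: "0 < p" and F: "extremal t F"
  shows "\<exists>F'. extremal t F' \<and> insert_closed F' \<and> F' \<subseteq> F \<and> prob (F - F') = 0"
proof -
  have ev: "F \<in> events" using F by (simp add: extremal_def)
  define N where "N E = F - {A. A \<union> E \<in> F}" for E
  have N: "N E \<in> events \<and> prob (N E) = 0" if "finite E" for E
    using that
  proof (induction E rule: finite_induct)
    case empty
    then show ?case by (simp add: N_def)
  next
    case (insert i E)
    define V where "V = F - {A. insert i A \<in> F}"
    have V: "V \<in> events" "prob V = 0"
    proof -
      show "V \<in> events" unfolding V_def using ev by (intro sets.Diff sets_insert_cube)
      have "V = {A \<in> F. insert i A \<notin> F}" by (auto simp: V_def)
      then show "prob V = 0" using extremal_almost_insert_closed[OF p F, of i] by simp
    qed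
    have "N (insert i E) \<subseteq> N E \<union> {A. A \<union> E \<in> V}" by (auto simp: N_def V_def)
    moreover have "prob (N E \<union> {A. A \<union> E \<in> V}) = 0"
      using insert V by (intro null_Un union_events null_union p) auto
    moreover have "N E \<union> {A. A \<union> E \<in> V} \<in> events"
      using insert V by (intro sets.Un union_events) auto
    moreover have "N (insert i E) \<in> events"
      unfolding N_def using ev insert by (intro sets.Diff union_events) auto
    ultimately show ?case using null_mono by blast
  qed
  define F' where "F' = F - (\<Union>E\<in>{E. finite E}. N E)"
  have U: "(\<Union>E\<in>{E. finite E}. N E) \<in> null_sets (cube p)"
    using N by (intro null_sets_UN' countable_Collect_finite)
      (simp add: null_sets_def emeasure_eq_measure)
  have mem: "A \<in> F' \<longleftrightarrow> (\<forall>E. finite E \<longrightarrow> A \<union> E \<in> F)" for A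
  proof
    assume A: "\<forall>E. finite E \<longrightarrow> A \<union> E \<in> F"
    then have "A \<in> F" by (metis finite.emptyI Un_empty_right)
    then show "A \<in> F'" using A by (simp add: F'_def N_def)
  qed (auto simp: F'_def N_def)
  have "insert_closed F'"
    unfolding insert_closed_def
  proof (intro ballI allI)
    fix A i assume "A \<in> F'"
    then have "A \<union> insert i E \<in> F" if "finite E" for E
      using that unfolding mem by blast
    then show "insert i A \<in> F'" unfolding mem by simp
  qed
  moreover have ev': "F' \<in> events" unfolding F'_def using U ev by (auto simp: null_sets_def)
  moreover have sub: "F' \<subseteq> F" by (auto simp: F'_def)
  moreover have null: "prob (F - F') = 0"
  proof -
    have "F - F' \<subseteq> (\<Union>E\<in>{E. finite E}. N E)" by (auto simp: F'_def)
    then show ?thesis using U null_mono by (auto simp: null_sets_def measure_def)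
  qed
  moreover have "extremal t F'"
  proof -
    have "prob F' = prob F" using null sub ev ev' by (simp add: finite_measure_Diff)
    then show ?thesis using F ev' sub unfolding extremal_def t_intersecting_def by auto
  qed
  ultimately show ?thesis by blast
qed

text \<open>An invariant of successive compressions inside the first \<open>m\<close> coordinates.
  The last clause bounds the distance to the families determined by \<open>m\<close> without
  tracking which compressions were made.\<close>

definition compresses_to :: "nat \<Rightarrow> nat \<Rightarrow> nat set set \<Rightarrow> nat set set \<Rightarrow> bool" where
  "compresses_to t m F F' \<longleftrightarrow> extremal t F' \<and> insert_closed F' \<and>
    (\<forall>D. determined m D \<longrightarrow> (\<exists>D'. determined m D' \<and> prob (sym_diff F' D') \<le> prob (sym_diff F D)))"

lemma compresses_to_compress:
  assumes F: "compresses_to t m F F'" and jk: "j < m" "k < m" "j \<noteq> k"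
  shows "compresses_to t m F (compress j k F')"
  unfolding compresses_to_def
proof (intro conjI allI impI)
  have F': "extremal t F'" "insert_closed F'" "F' \<in> events" "t_intersecting t F'"
    using F by (auto simp: compresses_to_def extremal_def)
  then show "extremal t (compress j k F')" "insert_closed (compress j k F')"
    using jk by (auto simp: extremal_def compress_events t_intersecting_compress prob_compress
        insert_closed_compress)
  fix D assume "determined m D"
  then obtain D' where D': "determined m D'" "prob (sym_diff F' D') \<le> prob (sym_diff F D)"
    using F by (auto simp: compresses_to_def)
  then show "\<exists>D'. determined m D' \<and> prob (sym_diff (compress j k F') D') \<le> prob (sym_diff F D)"
    using prob_sym_diff_compress_le[OF F'(3) determined_events[OF D'(1)] jk(3)]
      determined_compress[OF D'(1) jk(1,2)] by (meson order_trans)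
qed

lemma compress_towards_initial_segment:
  assumes F: "compresses_to t m F F'" and "n \<le> k" "k < m" "l \<le> n"
  shows "\<exists>F''. compresses_to t m F F'' \<and> (\<forall>j<l. compressed j k F'') \<and>
    (\<forall>i\<ge>n. i \<noteq> k \<longrightarrow> prob (pivotal i F'') = prob (pivotal i F'))"
  using \<open>l \<le> n\<close>
proof (induction l)
  case 0
  then show ?case using F by blast
next
  case (Suc l)
  then obtain G where G: "compresses_to t m F G" "\<forall>j<l. compressed j k G"
    "\<forall>i\<ge>n. i \<noteq> k \<longrightarrow> prob (pivotal i G) = prob (pivotal i F')" by auto
  have l: "l < m" "l \<noteq> k" "l < n" using Suc assms by auto
  have "\<forall>j<Suc l. compressed j k (compress l k G)"
    using G(2) l assms by (auto simp: less_Suc_eq compressed_compress compressed_compress_other)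
  moreover have "prob (pivotal i (compress l k G)) = prob (pivotal i G)" if "i \<ge> n" "i \<noteq> k" for i
    using G(1) that l by (intro prob_pivotal_compress) (auto simp: compresses_to_def extremal_def)
  ultimately show ?case
    using compresses_to_compress[OF G(1) l(1) assms(3) l(2)] G(3) by auto
qed

text \<open>The coordinates from \<open>n\<close> to \<open>m - 1\<close> are treated in turn.
  Shifting \<open>k\<close> towards all \<open>j < n\<close> makes its influence zero and otherwise
  affects only influences below \<open>n\<close>, so zeros obtained earlier persist.\<close>

lemma compress_to_initial_segment:
  assumes F: "extremal t F" "insert_closed F" and t: "1 \<le> t" and "n \<le> m"
    and large: "t * real (n choose (n div 2)) < (1 - 2 * p) * 2 ^ n"
  shows "\<exists>F'. compresses_to t m F F' \<and> (\<forall>i. n \<le> i \<longrightarrow> i < m \<longrightarrow> prob (pivotal i F') = 0) \<and>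
    (\<forall>i\<ge>m. prob (pivotal i F') = prob (pivotal i F))"
proof -
  have "\<exists>F'. compresses_to t m F F' \<and> (\<forall>i. n \<le> i \<longrightarrow> i < k \<longrightarrow> prob (pivotal i F') = 0) \<and>
    (\<forall>i\<ge>k. prob (pivotal i F') = prob (pivotal i F))" if "n \<le> k" "k \<le> m" for k
    using that
  proof (induction k rule: dec_induct)
    case base
    have "compresses_to t m F F" using F by (auto simp: compresses_to_def)
    then show ?case by auto
  next
    case (step k)
    then obtain G where G: "compresses_to t m F G"
      "\<forall>i. n \<le> i \<longrightarrow> i < k \<longrightarrow> prob (pivotal i G) = 0"
      "\<forall>i\<ge>k. prob (pivotal i G) = prob (pivotal i F)" by auto
    obtain H where H: "compresses_to t m F H" "\<forall>j<n. compressed j k H"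
      "\<forall>i\<ge>n. i \<noteq> k \<longrightarrow> prob (pivotal i H) = prob (pivotal i G)"
      using compress_towards_initial_segment[OF G(1), of n k n] step by auto
    have "prob (pivotal k H) = 0"
      using H(1,2) by (intro extremal_compressed_pivotal_null[OF _ _ _ _ step(1) _ t large])
        (auto simp: compresses_to_def extremal_def)
    then have "\<forall>i. n \<le> i \<longrightarrow> i < Suc k \<longrightarrow> prob (pivotal i H) = 0"
      using G(2) H(3) by (auto simp: less_Suc_eq)
    moreover have "\<forall>i\<ge>Suc k. prob (pivotal i H) = prob (pivotal i F)"
      using G(3) H(3) step(1) by auto
    ultimately show ?case using H(1) by blast
  qed
  then show ?thesis using \<open>n \<le> m\<close> by blast
qed

section \<open>Rigidity of extremal families close to a determined one\<close>

lemma sum_weight: "(\<Sum>A\<in>Pow {..<n}. weight n A) = 1"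
  using prob_determined[of n UNIV] prob_UNIV by (simp add: determined_def)

lemma weight_ge:
  assumes "p \<le> 1/2" "A \<subseteq> {..<n}" shows "p ^ n \<le> weight n A"
proof -
  have c: "card A \<le> n" using card_mono[of "{..<n}" A] assms by simp
  have "p ^ n = p ^ card A * p ^ (n - card A)" using c by (simp add: power_add[symmetric])
  also have "\<dots> \<le> weight n A"
    unfolding weight_def using assms p_nonneg by (intro mult_left_mono power_mono) auto
  finally show ?thesis .
qed

lemma finite_gap:
  fixes V :: "real set" assumes "finite V"
  shows "\<exists>\<delta>>0. \<forall>v\<in>V. v < c \<longrightarrow> v \<le> c - \<delta>"
proof (cases "{v\<in>V. v < c} = {}")
  case True
  then show ?thesis by (intro exI[of _ 1]) auto
next
  case False
  have fin: "finite {v\<in>V. v < c}" using assms by simp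
  have "Max {v\<in>V. v < c} \<in> {v\<in>V. v < c}" using fin False by (rule Max_in)
  moreover have "v \<le> Max {v\<in>V. v < c}" if "v \<in> V" "v < c" for v
    using that fin by (intro Max_ge) auto
  ultimately show ?thesis by (intro exI[of _ "c - Max {v\<in>V. v < c}"]) auto
qed

text \<open>Rounding a section of measure \<open>f\<close> close to \<open>0\<close> down frees, in any conflicting section of
  measure close to \<open>1\<close>, the much larger amount \<open>f powr (1 / \<gamma>)\<close>.\<close>

lemma extremal_near_determined:
  assumes p: "0 < p" "p < 1/2" and t: "1 \<le> t"
  shows "\<exists>\<eta>>0. \<forall>F D. extremal t F \<longrightarrow> prob F = c \<longrightarrow> determined n D \<longrightarrow> prob (sym_diff F D) < \<eta> \<longrightarrow>
    prob (sym_diff F D) = 0"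
proof -
  define \<gamma> where "\<gamma> = ln p / ln (1 - p)"
  have \<gamma>: "1 < \<gamma>" "(1 - p) powr \<gamma> = p"
    using p by (auto simp: \<gamma>_def powr_def less_divide_eq)
  \<comment> \<open>Chosen so that \<open>\<kappa> powr (\<gamma> - 1) < p ^ n\<close>, which the
    final contradiction needs; the bound 1/4 keeps errors on traces below 1/2, so that
    \<open>D\<close> is the rounding of \<open>F\<close>.\<close>
  define \<kappa> where "\<kappa> = min (1/4) ((p ^ n / 2) powr (1 / (\<gamma> - 1)))"
  have \<kappa>: "0 < \<kappa>" "\<kappa> < 1/2" using p by (auto simp: \<kappa>_def)
  have "\<kappa> powr (\<gamma> - 1) \<le> ((p ^ n / 2) powr (1 / (\<gamma> - 1))) powr (\<gamma> - 1)"
    using \<gamma> \<kappa> by (intro powr_mono2) (auto simp: \<kappa>_def)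
  also have "\<dots> = p ^ n / 2" using \<gamma> p by (simp add: powr_powr)
  also have "\<dots> < p ^ n" using p by simp
  finally have \<kappa>\<gamma>: "\<kappa> powr (\<gamma> - 1) < p ^ n" .
  have "finite (prob ` {D. determined n D})" using finite_determined by blast
  from finite_gap[OF this] obtain \<delta> where \<delta>: "0 < \<delta>" "\<And>D. determined n D \<Longrightarrow> prob D < c \<Longrightarrow> prob D \<le> c - \<delta>"
    by blast
  \<comment> \<open>The bound \<open>\<delta>\<close> forces \<open>prob D = c\<close>. The other
    bound makes the error on every single trace less than \<open>\<kappa>\<close>, since every trace
    has weight at least \<open>p ^ n\<close>.\<close>
  define \<eta> where "\<eta> = min \<delta> (\<kappa> * p ^ n)"
  have "prob (sym_diff F D) = 0" if ext: "extremal t F" and c: "prob F = c" and D: "determined n D"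
    and near: "prob (sym_diff F D) < \<eta>" for F D
  proof -
    have F: "F \<in> events" "t_intersecting t F" "\<And>G. G \<in> events \<Longrightarrow> t_intersecting t G \<Longrightarrow> prob G \<le> c"
      using ext c by (auto simp: extremal_def)
    define f where "f A = prob (sec n F A)" for A
    have f01: "0 \<le> f A" "f A \<le> 1" for A by (simp_all add: f_def)
    define g where "g A = (if A \<in> D then 1 - f A else f A)" for A
    have g0: "0 \<le> g A" for A using f01 by (simp add: g_def)
    have w: "p ^ n \<le> weight n A" if "A \<in> Pow {..<n}" for A using weight_ge p that by simp
    have pn: "0 < p ^ n" using p by simp
    have sd: "prob (sym_diff F D) = (\<Sum>A\<in>Pow {..<n}. weight n A * g A)"
      unfolding g_def f_def by (rule prob_sym_diff_determined[OF D F(1)])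
    have small: "g A < \<kappa>" if A: "A \<in> Pow {..<n}" for A
    proof -
      have "p ^ n * g A \<le> weight n A * g A" using w[OF A] g0 by (intro mult_right_mono) auto
      also have "\<dots> \<le> (\<Sum>A\<in>Pow {..<n}. weight n A * g A)"
        using A g0 weight_nonneg by (intro member_le_sum) auto
      also have "\<dots> < \<kappa> * p ^ n" using near by (simp add: sd \<eta>_def)
      finally show ?thesis using pn by (simp add: mult.commute)
    qed
    have "D = rounding n F"
    proof (rule set_eqI)
      fix C
      have "C \<inter> {..<n} \<in> D \<longleftrightarrow> 1/2 < f (C \<inter> {..<n})"
        using small[of "C \<inter> {..<n}"] \<kappa> by (auto simp: g_def split: if_splits)
      then show "C \<in> D \<longleftrightarrow> C \<in> rounding n F"
        using D by (simp add: determined_def rounding_def f_def)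
    qed
    then have Dt: "t_intersecting t D" using t_intersecting_rounding[OF _ F(1,2)] p by simp
    have evD: "D \<in> events" using D by (rule determined_events)
    have "prob D = c"
    proof -
      have "\<bar>prob F - prob D\<bar> < \<delta>" using prob_diff_le_sym_diff[OF F(1) evD] near by (simp add: \<eta>_def)
      then show ?thesis using \<delta>(2)[OF D] F(3)[OF evD Dt] c by linarith
    qed
    have "c > 0"
    proof -
      have "t_intersecting t {A. {..<t} \<subseteq> A}"
        unfolding t_intersecting_at_least
      proof (intro ballI)
        fix A B assume "A \<in> {A. {..<t} \<subseteq> A}" "B \<in> {A. {..<t} \<subseteq> A}"
        then have "{..<t} \<subseteq> A \<inter> B" by simp
        moreover have "at_least t {..<t}" by (simp add: at_least_def)
        ultimately show "at_least t (A \<inter> B)" using at_least_mono by blast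
      qed
      then have "prob {A. {..<t} \<subseteq> A} \<le> c" by (intro F(3)) (simp add: sets_cube_superset)
      moreover have "0 < p ^ t" using p by simp
      ultimately show ?thesis by (simp add: measure_cube_superset p_nonneg p_le_1)
    qed
    let ?I = "Pow {..<n} \<inter> D" and ?O = "Pow {..<n} - D"
    have split: "(\<Sum>A\<in>Pow {..<n}. h A) = (\<Sum>A\<in>?I. h A) + (\<Sum>A\<in>?O. h A)" for h :: "nat set \<Rightarrow> real"
      by (rule sum.Int_Diff) simp
    have "(\<Sum>A\<in>?I. weight n A) = (\<Sum>A\<in>?I. weight n A * f A) + (\<Sum>A\<in>?O. weight n A * f A)"
      using \<open>prob D = c\<close> c prob_determined[OF D] prob_sections[OF F(1), of n] split[of "\<lambda>A. weight n A * f A"]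
      by (simp add: f_def)
    \<comment> \<open>As \<open>F\<close> and \<open>D\<close> have equal measure, what
      \<open>F\<close> misses inside \<open>D\<close> equals what it has outside.\<close>
    then have balance: "(\<Sum>A\<in>?I. weight n A * (1 - f A)) = (\<Sum>A\<in>?O. weight n A * f A)"
      by (simp add: algebra_simps sum_subtractf)
    have zero: "f A = 0" if A: "A \<in> ?O" for A
    proof (rule ccontr)
      assume "f A \<noteq> 0"
      define \<epsilon> where "\<epsilon> = Max (f ` ?O)"
      have fin: "finite (f ` ?O)" "f ` ?O \<noteq> {}" using A by auto
      have \<epsilon>max: "f B \<le> \<epsilon>" if "B \<in> ?O" for B using that fin by (auto simp: \<epsilon>_def)
      have \<epsilon>: "0 < \<epsilon>" using \<epsilon>max[OF A] \<open>f A \<noteq> 0\<close> f01[of A] by linarith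
      obtain A0 where A0: "A0 \<in> ?O" "f A0 = \<epsilon>" using Max_in[OF fin] by (auto simp: \<epsilon>_def)
      \<comment> \<open>A trace in conflict with no trace of \<open>D\<close> could be added to
        \<open>D\<close>, giving a t-intersecting family of measure larger than
        \<open>c\<close>.\<close>
      have "\<exists>B\<in>?I. \<not> at_least t (A0 \<inter> B)"
      proof (rule ccontr)
        assume neg: "\<not> ?thesis"
        \<comment> \<open>The added trace must also have \<open>t\<close> elements itself; it
          inherits them from its intersection with any trace of \<open>D\<close>, and one exists
          because \<open>c > 0\<close>.\<close>
        have "?I \<noteq> {}" using \<open>c > 0\<close> \<open>prob D = c\<close> prob_determined[OF D] by auto
        then obtain B where "at_least t (A0 \<inter> B)" using neg by blast
        then have A0t: "at_least t A0" by (rule at_least_mono) auto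
        define D' where "D' = D \<union> {C. C \<inter> {..<n} = A0}"
        have A0n: "A0 \<inter> {..<n} = A0" using A0 by auto
        have D': "determined n D'" using D by (auto simp: determined_def D'_def Int_assoc)
        have 1: "at_least t (X \<inter> Y)" if X: "X \<in> {C. C \<inter> {..<n} = A0}" and Y: "Y \<in> D'" for X Y
        proof -
          have "at_least t (A0 \<inter> (Y \<inter> {..<n}))"
          proof (cases "Y \<in> D")
            case True
            then have "Y \<inter> {..<n} \<in> ?I" using D by (simp add: determined_def)
            then show ?thesis using neg by blast
          next
            case False
            then show ?thesis using Y A0t by (simp add: D'_def)
          qed
          then show ?thesis by (rule at_least_mono) (use X in auto)
        qed
        have "t_intersecting t D'"
          unfolding t_intersecting_at_least
        proof (intro ballI)
          fix X Y assume XY: "X \<in> D'" "Y \<in> D'"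
          then show "at_least t (X \<inter> Y)"
            using 1[of X Y] 1[of Y X] Dt by (auto simp: D'_def t_intersecting_at_least Int_commute)
        qed
        then have "prob D' \<le> c" using D' determined_events F(3) by blast
        moreover have "prob D' = c + weight n A0"
        proof -
          have "Pow {..<n} \<inter> D' = insert A0 ?I" using A0 A0n by (auto simp: D'_def)
          then show ?thesis
            using A0 \<open>prob D = c\<close> by (simp add: prob_determined[OF D'] prob_determined[OF D])
        qed
        ultimately show False using w[of A0] A0 pn by auto
      qed
      then obtain B where B: "B \<in> ?I" "\<not> at_least t (A0 \<inter> B)" by blast
      define d where "d = 1 - f B"
      have d: "0 \<le> d" "d < \<kappa>" using f01[of B] small[of B] B by (auto simp: d_def g_def)
      have "cross_intersecting (sec n F A0) (sec n F B)"
        using F(2) A0 B by (intro sec_cross_intersecting[where R = "at_least t"])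
          (auto simp: t_intersecting_at_least)
      then have e1: "\<epsilon> \<le> d powr \<gamma>"
        using cross_intersecting_powr[of \<gamma> "sec n F A0" "sec n F B"] p \<gamma> F(1) A0
        by (simp add: sec_events f_def d_def)
      \<comment> \<open>The loss at \<open>B\<close> alone is at least \<open>p ^ n * d\<close>. By
        \<open>balance\<close> it is at most the mass outside \<open>D\<close>, hence at most
        \<open>\<epsilon> \<le> d powr \<gamma>\<close>; for \<open>0 < d < \<kappa>\<close> this is
        impossible.\<close>
      have "p ^ n * d \<le> weight n B * (1 - f B)"
        using w[of B] B d by (simp add: d_def mult_right_mono)
      also have "\<dots> \<le> (\<Sum>A\<in>?I. weight n A * (1 - f A))"
        using B f01 weight_nonneg by (intro member_le_sum) auto
      also have "\<dots> \<le> (\<Sum>A\<in>?O. weight n A * \<epsilon>)"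
        unfolding balance using \<epsilon>max weight_nonneg by (intro sum_mono mult_left_mono) auto
      also have "\<dots> \<le> (\<Sum>A\<in>Pow {..<n}. weight n A * \<epsilon>)"
        using \<epsilon> weight_nonneg by (intro sum_mono2) auto
      also have "\<dots> = \<epsilon>" by (simp add: sum_distrib_right[symmetric] sum_weight)
      finally have e2: "p ^ n * d \<le> d powr \<gamma>" using e1 by simp
      have d0: "0 < d" using e1 \<epsilon> d \<gamma> by (cases "d = 0") auto
      then have "d powr \<gamma> = d * d powr (\<gamma> - 1)" by (simp add: powr_mult_base)
      then have "p ^ n \<le> d powr (\<gamma> - 1)" using e2 d0 by (simp add: mult.commute)
      also have "\<dots> \<le> \<kappa> powr (\<gamma> - 1)" using d \<gamma> by (intro powr_mono2) auto
      finally show False using \<kappa>\<gamma> by simp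
    qed
    have "(\<Sum>A\<in>?O. weight n A * f A) = 0" using zero by simp
    moreover have "(\<Sum>A\<in>Pow {..<n}. weight n A * g A)
        = (\<Sum>A\<in>?I. weight n A * (1 - f A)) + (\<Sum>A\<in>?O. weight n A * f A)"
      unfolding split by (intro arg_cong2[where f = "(+)"] sum.cong) (auto simp: g_def)
    ultimately show ?thesis using sd balance by simp
  qed
  moreover have "0 < \<eta>" using \<delta> \<kappa> p by (simp add: \<eta>_def)
  ultimately show ?thesis by blast
qed

lemma extremal_imp_determined:
  assumes p: "0 < p" "p < 1/2" and t: "1 \<le> t" and ext: "extremal t F"
  shows "\<exists>n D. determined n D \<and> prob (sym_diff F D) = 0"
proof -
  obtain F1 where F1: "extremal t F1" "insert_closed F1" "F1 \<subseteq> F" "prob (F - F1) = 0"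
    using extremal_insert_closed_core[OF p(1) ext] by blast
  have ev: "F \<in> events" "F1 \<in> events" using ext F1 by (auto simp: extremal_def)
  obtain m0 where m0: "\<forall>m\<ge>m0. real ((2 * m) choose m) < ((1 - 2 * p) / t) * 2 ^ (2 * m)"
    using central_binomial_small[of "(1 - 2 * p) / t"] p t by auto
  define n where "n = 2 * m0"
  have large: "t * real (n choose (n div 2)) < (1 - 2 * p) * 2 ^ n"
    using m0[rule_format, of m0] t by (simp add: n_def field_simps)
  obtain \<eta> where \<eta>: "\<eta> > 0" "\<And>F' D. extremal t F' \<Longrightarrow> prob F' = prob F1 \<Longrightarrow> determined n D \<Longrightarrow>
      prob (sym_diff F' D) < \<eta> \<Longrightarrow> prob (sym_diff F' D) = 0"
    using extremal_near_determined[OF p t, of "prob F1" n] by blast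
  obtain m1 D1 where D1: "determined m1 D1" "prob (sym_diff F1 D1) < \<eta>"
    using events_approx[OF ev(2) \<eta>(1)] by blast
  define m where "m = max n m1"
  have D1m: "determined m D1" by (rule determined_mono[OF D1(1)]) (simp add: m_def)
  obtain F2 where F2: "compresses_to t m F1 F2"
    "\<forall>i. n \<le> i \<longrightarrow> i < m \<longrightarrow> prob (pivotal i F2) = 0"
    "\<forall>i\<ge>m. prob (pivotal i F2) = prob (pivotal i F1)"
    using compress_to_initial_segment[OF F1(1,2) t _ large, of m] by (auto simp: m_def)
  have ext2: "extremal t F2" "F2 \<in> events" using F2(1) by (auto simp: compresses_to_def extremal_def)
  obtain D2 where D2: "determined m D2" "prob (sym_diff F2 D2) \<le> prob (sym_diff F1 D1)"
    using F2(1) D1m by (auto simp: compresses_to_def)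
  obtain D3 where D3: "determined n D3" "prob (sym_diff F2 D3) \<le> prob (sym_diff F2 D2)"
    using eliminate_coordinates[OF ext2(2) _ _ D2(1), of n] F2(2) by (auto simp: m_def)
  have "prob F2 = prob F1"
    using ext2(1) F1(1) by (auto simp: extremal_def intro: antisym)
  then have null: "prob (sym_diff F2 D3) = 0"
    using \<eta>(2)[OF ext2(1) _ D3(1)] D1(2) D2(2) D3(2) by simp
  \<comment> \<open>\<open>F2\<close> agrees with \<open>D3\<close> almost everywhere, so its
    influences from \<open>n\<close> on vanish. From \<open>m\<close> on they are those of
    \<open>F1\<close>, which is thus determined by \<open>m\<close> coordinates, not necessarily by
    \<open>n\<close>.\<close>
  have "prob (pivotal i F1) = 0" if i: "m \<le> i" for i
  proof -
    define X where "X = sym_diff F2 D3"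
    have X: "X \<in> events" "prob X = 0"
      using ext2 determined_events[OF D3(1)] null by (auto simp: X_def)
    have "i \<ge> n" using i by (simp add: m_def)
    then have "insert i A \<inter> {..<n} = (A - {i}) \<inter> {..<n}" for A by auto
    then have "insert i A \<in> D3 \<longleftrightarrow> A - {i} \<in> D3" for A
      using D3(1) unfolding determined_def by metis
    then have "pivotal i F2 \<subseteq> {A. insert i A \<in> X} \<union> {A. A - {i} \<in> X}"
      unfolding pivotal_def X_def by blast
    moreover have "prob ({A. insert i A \<in> X} \<union> {A. A - {i} \<in> X}) = 0"
      using X p by (intro null_Un sets_insert_cube sets_remove_cube null_insert null_remove) auto
    moreover have "{A. insert i A \<in> X} \<union> {A. A - {i} \<in> X} \<in> events"
      using X by (intro sets.Un sets_insert_cube sets_remove_cube)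
    ultimately have "prob (pivotal i F2) = 0" using null_mono by blast
    then show ?thesis using F2(3) i by simp
  qed
  then obtain D where D: "determined m D" "prob (sym_diff F1 D) = 0"
    using pivotal_null_imp_determined[OF ev(2)] by blast
  have "sym_diff F D \<subseteq> (F - F1) \<union> sym_diff F1 D" using F1(3) by auto
  moreover have "prob ((F - F1) \<union> sym_diff F1 D) = 0"
    using ev determined_events[OF D(1)] by (intro null_Un[OF _ _ F1(4) D(2)]) auto
  moreover have "(F - F1) \<union> sym_diff F1 D \<in> events"
    using ev determined_events[OF D(1)] by auto
  ultimately have "prob (sym_diff F D) = 0" using null_mono by blast
  then show ?thesis using D(1) by blast
qed

end

section \<open>The three regimes\<close>

text \<open>An inner approximation is taken because t-intersection passes to subfamilies.\<close>

lemma mu_core: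
  assumes "F \<in> sets (mu p)"
  shows "\<exists>F'. F' \<subseteq> F \<and> F' \<in> sets (cube p) \<and> measure (cube p) F' = measure (mu p) F
    \<and> F - F' \<in> null_sets (mu p)"
proof (intro exI conjI)
  have F: "F \<in> sets (completion (cube p))" using assms by (simp add: mu_eq_completion)
  show "main_part (cube p) F \<subseteq> F" using main_part_null_part_Un[OF F] by blast
  show "main_part (cube p) F \<in> sets (cube p)" using F by simp
  show "measure (cube p) (main_part (cube p) F) = measure (mu p) F"
    using F by (simp add: mu_eq_completion measure_def)
  have "F - main_part (cube p) F = null_part (cube p) F"
    using main_part_null_part_Un[OF F] main_part_null_part_Int[OF F] by blast
  then show "F - main_part (cube p) F \<in> null_sets (mu p)"
    using null_part_null_sets[OF F] by (simp add: mu_eq_completion)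
qed

lemma sets_mu: "F \<in> sets (cube p) \<Longrightarrow> F \<in> sets (mu p)"
  by (simp add: mu_eq_completion)

lemma measure_mu: "F \<in> sets (cube p) \<Longrightarrow> measure (mu p) F = measure (cube p) F"
  by (simp add: mu_eq_completion)

lemma t_intersecting_subset: "t_intersecting t F \<Longrightarrow> G \<subseteq> F \<Longrightarrow> t_intersecting t G"
  by (auto simp: t_intersecting_def)

text \<open>Testing only sizes 2 * k^2 keeps the threshold an integer. The surplus \<open>k\<close>
  is unbounded, which forces infinite intersections, but is of lower order than the size, so every
  density above 1/2 exceeds it eventually.\<close>

definition sparse_majority :: "nat set set" where
  "sparse_majority = {A. \<exists>k0. \<forall>k\<ge>k0. k\<^sup>2 + k \<le> card (A \<inter> {..<2 * k\<^sup>2})}"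

lemma infinite_Int_sparse_majority:
  assumes "A \<in> sparse_majority" "B \<in> sparse_majority"
  shows "infinite (A \<inter> B)"
proof
  assume fin: "finite (A \<inter> B)"
  obtain k1 k2 where k: "\<forall>k\<ge>k1. k\<^sup>2 + k \<le> card (A \<inter> {..<2 * k\<^sup>2})" "\<forall>k\<ge>k2. k\<^sup>2 + k \<le> card (B \<inter> {..<2 * k\<^sup>2})"
    using assms by (auto simp: sparse_majority_def)
  \<comment> \<open>Beyond both thresholds, and so large that the guaranteed \<open>2 * k\<close>
    common elements exceed \<open>card (A \<inter> B)\<close>.\<close>
  define k where "k = k1 + k2 + card (A \<inter> B) + 1"
  let ?N = "{..<2 * k\<^sup>2}"
  have "card (A \<inter> ?N) + card (B \<inter> ?N)
      = card ((A \<inter> ?N) \<union> (B \<inter> ?N)) + card ((A \<inter> ?N) \<inter> (B \<inter> ?N))"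
    by (intro card_Un_Int) auto
  moreover have "card ((A \<inter> ?N) \<union> (B \<inter> ?N)) \<le> card ?N" by (intro card_mono) auto
  moreover have "card ((A \<inter> ?N) \<inter> (B \<inter> ?N)) \<le> card (A \<inter> B)" by (intro card_mono fin) auto
  moreover have "k\<^sup>2 + k \<le> card (A \<inter> ?N)" "k\<^sup>2 + k \<le> card (B \<inter> ?N)"
    using k(1)[rule_format, of k] k(2)[rule_format, of k] unfolding k_def by linarith+
  ultimately have "2 * k \<le> card (A \<inter> B)" by simp
  then show False by (simp add: k_def)
qed

lemma sparse_majority_sets: "sparse_majority \<in> sets (cube p)"
proof -
  have "{A. k\<^sup>2 + k \<le> card (A \<inter> {..<2 * k\<^sup>2})} \<in> sets (cube p)" for k
    using sets_cube_finite_pred[of "{..<2 * k\<^sup>2}" "\<lambda>B. k\<^sup>2 + k \<le> card B" p] by simp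
  then have "(\<Union>k0. \<Inter>k\<in>{k0..}. {A. k\<^sup>2 + k \<le> card (A \<inter> {..<2 * k\<^sup>2})}) \<in> sets (cube p)"
    by (intro sets.countable_UN sets.countable_INT') auto
  moreover have "(\<Union>k0. \<Inter>k\<in>{k0..}. {A. k\<^sup>2 + k \<le> card (A \<inter> {..<2 * k\<^sup>2})}) = sparse_majority"
    by (auto simp: sparse_majority_def)
  ultimately show ?thesis by simp
qed

section \<open>Almost sure membership in the sparse majority family for p > 1/2\<close>

context biased_cube
begin

lemma weight_le:
  assumes "1/2 \<le> p" "card A \<le> b" "b \<le> n"
  shows "weight n A \<le> p ^ b * (1 - p) ^ (n - b)"
proof -
  have "(1 - p) ^ (n - card A) = (1 - p) ^ (b - card A) * (1 - p) ^ (n - b)"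
    using assms by (simp add: power_add[symmetric])
  also have "\<dots> \<le> p ^ (b - card A) * (1 - p) ^ (n - b)"
    using assms p_le_1 by (intro mult_right_mono power_mono) auto
  finally have "weight n A \<le> p ^ card A * (p ^ (b - card A) * (1 - p) ^ (n - b))"
    unfolding weight_def using p_nonneg by (intro mult_left_mono) auto
  also have "\<dots> = p ^ b * (1 - p) ^ (n - b)"
    using assms by (simp add: power_add[symmetric] mult.assoc[symmetric])
  finally show ?thesis .
qed

text \<open>For \<open>p \<ge> 1/2\<close> the weight is largest at the maximal size, and the crude
  count of 2 ^ n sets suffices: it combines with the balanced part of the weight to (4 * p * (1 -
  p)) ^ (k^2), while the surplus costs only (p / (1 - p)) ^ k.\<close>

lemma prob_few_le:
  assumes "1/2 \<le> p" "p < 1"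
  shows "prob {A. card (A \<inter> {..<2 * k\<^sup>2}) < k\<^sup>2 + k} \<le> ((4 * p * (1 - p)) ^ k * (p / (1 - p))) ^ k"
    (is "prob ?B \<le> _")
proof -
  define n where "n = 2 * k\<^sup>2"
  have k: "k \<le> k\<^sup>2" by (simp add: power2_eq_square)
  have "determined n ?B" using determined_Collect[of n "\<lambda>A. card A < k\<^sup>2 + k"] by (simp add: n_def)
  then have "prob ?B = (\<Sum>A\<in>Pow {..<n} \<inter> ?B. weight n A)" by (rule prob_determined)
  also have "\<dots> \<le> (\<Sum>A\<in>Pow {..<n} \<inter> ?B. p ^ (k\<^sup>2 + k) * (1 - p) ^ (n - (k\<^sup>2 + k)))"
  proof (intro sum_mono weight_le assms(1))
    fix A assume A: "A \<in> Pow {..<n} \<inter> ?B"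
    then have "A \<inter> {..<2 * k\<^sup>2} = A" by (auto simp: n_def)
    then show "card A \<le> k\<^sup>2 + k" using A by simp
    show "k\<^sup>2 + k \<le> n" using k by (simp add: n_def)
  qed
  also have "\<dots> = real (card (Pow {..<n} \<inter> ?B)) * (p ^ (k\<^sup>2 + k) * (1 - p) ^ (k\<^sup>2 - k))"
    using k by (simp add: n_def)
  also have "\<dots> \<le> 2 ^ n * (p ^ (k\<^sup>2 + k) * (1 - p) ^ (k\<^sup>2 - k))"
  proof -
    have "card (Pow {..<n} \<inter> ?B) \<le> card (Pow {..<n})" by (intro card_mono) auto
    then have "card (Pow {..<n} \<inter> ?B) \<le> 2 ^ n" by (simp add: card_Pow)
    then have "real (card (Pow {..<n} \<inter> ?B)) \<le> 2 ^ n"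
      by (metis of_nat_le_iff of_nat_numeral of_nat_power)
    then show ?thesis using p_nonneg p_le_1 by (intro mult_right_mono) auto
  qed
  also have "\<dots> = 4 ^ (k * k) * p ^ (k * k) * (p ^ k * (1 - p) ^ (k * k - k))"
  proof -
    have "(2::real) ^ n = 4 ^ (k * k)" by (simp add: n_def power2_eq_square power_mult)
    then show ?thesis by (simp add: power_add power2_eq_square)
  qed
  also have "\<dots> = 4 ^ (k * k) * p ^ (k * k) * (p ^ k * (1 - p) ^ ((k - 1) * k))"
    by (simp add: diff_mult_distrib)
  also have "\<dots> = (4 ^ k * p ^ k * (p * (1 - p) ^ (k - 1))) ^ k"
    by (simp add: power_mult power_mult_distrib)
  also have "\<dots> = ((4 * p * (1 - p)) ^ k * (p / (1 - p))) ^ k"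
  proof (cases k)
    case (Suc j)
    have "(1 - p) ^ k / (1 - p) = (1 - p) ^ (k - 1)" using Suc assms by simp
    moreover have "(4 * p * (1 - p)) ^ k * (p / (1 - p)) = 4 ^ k * p ^ k * (p * ((1 - p) ^ k / (1 - p)))"
      by (simp only: power_mult_distrib times_divide_eq_right times_divide_eq_left mult_ac)
    ultimately have "4 ^ k * p ^ k * (p * (1 - p) ^ (k - 1)) = (4 * p * (1 - p)) ^ k * (p / (1 - p))"
      by (simp only:)
    then show ?thesis by simp
  qed simp
  finally show ?thesis .
qed

text \<open>The bound of \<open>prob_few_le\<close> is the k-th power of a quantity tending to 0, as
  4 * p * (1 - p) < 1, so it is summable and Borel-Cantelli applies.\<close>

lemma prob_sparse_majority:
  assumes p: "1/2 < p" "p < 1"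
  shows "prob sparse_majority = 1"
proof -
  define c where "c = 4 * p * (1 - p)"
  define B where "B k = {A. card (A \<inter> {..<2 * k\<^sup>2}) < k\<^sup>2 + k}" for k
  have "0 \<le> c" using p by (simp add: c_def)
  moreover have "c = 1 - (2 * p - 1)\<^sup>2" by (simp add: c_def power2_eq_square algebra_simps)
  ultimately have c: "0 \<le> c" "c < 1" using p by simp_all
  have B: "B k \<in> events" for k
    using sets_cube_finite_pred[of "{..<2 * k\<^sup>2}" "\<lambda>B. card B < k\<^sup>2 + k" p] by (simp add: B_def)
  have "(\<lambda>k. c ^ k * (p / (1 - p))) \<longlonglongrightarrow> 0 * (p / (1 - p))"
    using c by (intro tendsto_mult tendsto_const LIMSEQ_power_zero) auto
  then have "\<forall>\<^sub>F k in sequentially. c ^ k * (p / (1 - p)) < 1/2"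
    by (rule order_tendstoD) simp
  then have "\<forall>\<^sub>F k in sequentially. norm (prob (B k)) \<le> (1/2) ^ k"
  proof eventually_elim
    case (elim k)
    have "prob (B k) \<le> (c ^ k * (p / (1 - p))) ^ k"
      using prob_few_le[of k] p by (simp add: B_def c_def)
    also have "\<dots> \<le> (1/2) ^ k" using elim c p by (intro power_mono) auto
    finally show ?case by simp
  qed
  then have "summable (\<lambda>k. prob (B k))"
    by (rule summable_comparison_test_ev) (simp add: summable_geometric)
  then have "AE A in cube p. \<forall>\<^sub>F k in sequentially. A \<in> space (cube p) - B k"
    using B by (intro borel_cantelli_AE1) (auto simp: emeasure_eq_measure)
  then have "AE A in cube p. A \<in> sparse_majority"
    by (rule AE_mp) (auto simp: sparse_majority_def B_def eventually_sequentially not_less)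
  then show ?thesis using prob_eq_1[OF sparse_majority_sets] by simp
qed

section \<open>Comparison of finite families with families on infinitely many points\<close>

lemma prob_cylinder:
  assumes "G \<subseteq> Pow {..<n}"
  shows "prob {C. C \<inter> {..<n} \<in> G} = mu_fin n p G"
proof -
  have "Pow {..<n} \<inter> {C. C \<inter> {..<n} \<in> G} = G" using assms by (auto simp: Int_absorb2)
  then show ?thesis
    using prob_determined[OF determined_Collect[of n "\<lambda>B. B \<in> G"]] by (simp add: mu_fin_def weight_def)
qed

lemma finite_mu_fin_values: "finite {mu_fin n p \<G> |\<G>. \<G> \<subseteq> Pow {..<n} \<and> t_intersecting t \<G>}"
  by (rule finite_subset[of _ "mu_fin n p ` Pow (Pow {..<n})"]) auto

lemma mu_fin_le_w_fin:
  "G \<subseteq> Pow {..<n} \<Longrightarrow> t_intersecting t G \<Longrightarrow> mu_fin n p G \<le> w_fin n t p"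
  unfolding w_fin_def by (intro Max_ge finite_mu_fin_values) blast

lemma w_fin_attained: "\<exists>G\<subseteq>Pow {..<n}. t_intersecting t G \<and> w_fin n t p = mu_fin n p G"
proof -
  have "{mu_fin n p \<G> |\<G>. \<G> \<subseteq> Pow {..<n} \<and> t_intersecting t \<G>} \<noteq> {}"
    by (auto simp: t_intersecting_def intro!: exI[of _ "{}"])
  then have "w_fin n t p \<in> {mu_fin n p \<G> |\<G>. \<G> \<subseteq> Pow {..<n} \<and> t_intersecting t \<G>}"
    unfolding w_fin_def by (intro Max_in finite_mu_fin_values)
  then show ?thesis by auto
qed

lemma w_fin_realised: "\<exists>F\<in>events. t_intersecting t F \<and> prob F = w_fin n t p"
proof -
  obtain G where G: "G \<subseteq> Pow {..<n}" "t_intersecting t G" "w_fin n t p = mu_fin n p G"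
    using w_fin_attained by blast
  have "t_intersecting t {C. C \<inter> {..<n} \<in> G}"
    unfolding t_intersecting_at_least
  proof (intro ballI)
    fix A B assume "A \<in> {C. C \<inter> {..<n} \<in> G}" "B \<in> {C. C \<inter> {..<n} \<in> G}"
    then have "at_least t ((A \<inter> {..<n}) \<inter> (B \<inter> {..<n}))"
      using G(2) by (simp add: t_intersecting_at_least)
    then show "at_least t (A \<inter> B)" by (rule at_least_mono) auto
  qed
  then show ?thesis
    using determined_events[OF determined_Collect[of n "\<lambda>B. B \<in> G"]] prob_cylinder[OF G(1)] G(3)
    by auto
qed

lemma bdd_above_w_fin: "bdd_above ((\<lambda>n. w_fin n t p) ` N)"
proof (rule bdd_aboveI2)
  fix n
  show "w_fin n t p \<le> 1" using w_fin_realised[of t n] prob_le_1 by metis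
qed

lemma prob_le_w:
  assumes "p \<le> 1/2" "F \<in> events" "t_intersecting t F"
  shows "prob F \<le> w t p"
proof (rule field_le_epsilon)
  fix e :: real assume "e > 0"
  then obtain n0 where n0: "\<And>n. n0 \<le> n \<Longrightarrow> \<bar>prob F - prob (rounding n F)\<bar> < e"
    using rounding_approx[OF assms(2)] by blast
  \<comment> \<open>The supremum in \<open>w\<close> ranges only over lengths at least
    \<open>t\<close>.\<close>
  define n where "n = max n0 t"
  define D where "D = rounding n F"
  have det: "determined n D" unfolding D_def by (rule determined_rounding)
  then have D: "D = {C. C \<inter> {..<n} \<in> Pow {..<n} \<inter> D}" by (auto simp: determined_def)
  have "t_intersecting t D" unfolding D_def using assms by (rule t_intersecting_rounding)
  then have "t_intersecting t (Pow {..<n} \<inter> D)" by (rule t_intersecting_subset) auto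
  then have "mu_fin n p (Pow {..<n} \<inter> D) \<le> w_fin n t p" by (intro mu_fin_le_w_fin) auto
  then have "prob D \<le> w_fin n t p"
    using prob_cylinder[of "Pow {..<n} \<inter> D" n] D by simp
  also have "\<dots> \<le> w t p"
    unfolding w_def by (rule cSUP_upper[OF _ bdd_above_w_fin]) (simp add: n_def)
  finally show "prob F \<le> w t p + e" using n0[of n] by (simp add: n_def D_def)
qed

lemma w_inf_eqI:
  assumes "\<And>F. F \<in> events \<Longrightarrow> t_intersecting t F \<Longrightarrow> prob F \<le> s"
    and "\<And>e. e > 0 \<Longrightarrow> \<exists>F\<in>events. t_intersecting t F \<and> s - e < prob F"
  shows "w_inf t p = s"
  unfolding w_inf_def
proof (rule cSup_eq_non_empty)
  show "{measure (mu p) \<F> |\<F>. \<F> \<in> sets (mu p) \<and> t_intersecting t \<F>} \<noteq> {}"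
    by (auto simp: t_intersecting_def intro!: exI[of _ "{}"])
next
  fix x assume "x \<in> {measure (mu p) \<F> |\<F>. \<F> \<in> sets (mu p) \<and> t_intersecting t \<F>}"
  then obtain F where F: "F \<in> sets (mu p)" "t_intersecting t F" "x = measure (mu p) F" by auto
  obtain F' where "F' \<subseteq> F" "F' \<in> events" "prob F' = x"
    using mu_core[OF F(1)] F(3) by auto
  then show "x \<le> s" using assms(1)[of F'] t_intersecting_subset[OF F(2)] by auto
next
  fix y assume y: "\<And>x. x \<in> {measure (mu p) \<F> |\<F>. \<F> \<in> sets (mu p) \<and> t_intersecting t \<F>} \<Longrightarrow> x \<le> y"
  show "s \<le> y"
  proof (rule ccontr)
    assume "\<not> s \<le> y"
    then obtain F where F: "F \<in> events" "t_intersecting t F" "y < prob F"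
      using assms(2)[of "s - y"] by auto
    have "measure (mu p) F \<le> y" using sets_mu[OF F(1)] F(2) by (intro y) blast
    then show False using F measure_mu[OF F(1)] by simp
  qed
qed

lemma w_inf_eq_w:
  assumes "p \<le> 1/2" shows "w_inf t p = w t p"
proof (rule w_inf_eqI)
  fix e :: real assume "e > 0"
  then have "w t p - e < (SUP n\<in>{t..}. w_fin n t p)" by (simp add: w_def)
  moreover have "w t p - e < (SUP n\<in>{t..}. w_fin n t p) \<longleftrightarrow> (\<exists>n\<in>{t..}. w t p - e < w_fin n t p)"
    by (rule less_cSUP_iff[OF _ bdd_above_w_fin]) simp
  ultimately obtain n where "w t p - e < w_fin n t p" by blast
  then show "\<exists>F\<in>events. t_intersecting t F \<and> w t p - e < prob F"
    using w_fin_realised[of t n] by auto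
qed (use prob_le_w assms in auto)

lemma maximal_imp_essentially_finitely_determined:
  assumes p: "0 < p" "p < 1/2" and t: "1 \<le> t"
    and F: "F \<in> sets (mu p)" "t_intersecting t F" "measure (mu p) F = w_inf t p"
  shows "essentially_finitely_determined p F"
proof -
  obtain F' where F': "F' \<subseteq> F" "F' \<in> events" "prob F' = w t p" "F - F' \<in> null_sets (mu p)"
    using mu_core[OF F(1)] F(3) w_inf_eq_w[of t] p by auto
  have "extremal t F'"
    using F' t_intersecting_subset[OF F(2) F'(1)] prob_le_w p by (simp add: extremal_def)
  then obtain n D where D: "determined n D" "prob (sym_diff F' D) = 0"
    using extremal_imp_determined[OF p t] by blast
  have "finitely_determined D"
    unfolding finitely_determined_def
    using D(1) by (intro exI[of _ n] exI[of _ "D \<inter> Pow {..<n}"]) (auto simp: determined_def)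
  moreover have "sym_diff F D \<in> null_sets (mu p)"
  proof -
    have "sym_diff F' D \<in> null_sets (cube p)"
      using D F'(2) determined_events[OF D(1)] by (simp add: null_sets_def emeasure_eq_measure)
    then have "sym_diff F' D \<union> (F - F') \<in> null_sets (mu p)"
      using F'(4) null_sets_completionI by (auto simp: mu_eq_completion)
    moreover have "sym_diff F D \<subseteq> sym_diff F' D \<union> (F - F')" using F'(1) by auto
    ultimately show ?thesis unfolding mu_eq_completion by (rule null_sets_completion_subset[rotated])
  qed
  ultimately show ?thesis unfolding essentially_finitely_determined_def by blast
qed

lemma one_intersecting_prob_le:
  assumes "p \<le> 1/2" "F \<in> events" "t_intersecting t F" "1 \<le> t"
  shows "prob F \<le> 1/2"
proof -
  have "cross_intersecting F F"
    unfolding cross_intersecting_def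
  proof (intro ballI)
    fix A B assume "A \<in> F" "B \<in> F"
    then have "at_least t (A \<inter> B)" using assms(3) by (simp add: t_intersecting_at_least)
    then show "A \<inter> B \<noteq> {}" using assms(4) by (auto simp: at_least_def)
  qed
  then show ?thesis using cross_intersecting_prob_le[OF assms(1,2,2)] by simp
qed

end

text \<open>Complementation exchanges \<open>?U\<close> and \<open>?L\<close>, and the sets in
  neither have one of at most \<open>t\<close> consecutive sizes.\<close>

lemma card_large_subsets:
  assumes "t \<le> 2 * m"
  shows "2 ^ (2 * m) \<le> 2 * card {A \<in> Pow {..<2 * m}. 2 * m + t \<le> 2 * card A} + t * ((2 * m) choose m)"
proof -
  let ?P = "Pow {..<2 * m}"
  let ?U = "{A \<in> ?P. 2 * m + t \<le> 2 * card A}" and ?L = "{A \<in> ?P. 2 * card A + t \<le> 2 * m}"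
  \<comment> \<open>The least size of a set outside \<open>?L\<close>. A set that is also outside
    \<open>?U\<close> has \<open>2 * card A < 2 * m + t\<close>, hence size below
    \<open>l + t\<close> for either parity of \<open>t\<close>.\<close>
  define l where "l = (2 * m - t) div 2 + 1"
  let ?M = "{A \<in> ?P. l \<le> card A \<and> card A < l + t}"
  have "?P \<subseteq> ?U \<union> ?L \<union> ?M" using assms by (auto simp: l_def)
  then have "card ?P \<le> card (?U \<union> ?L \<union> ?M)" by (intro card_mono) auto
  also have "\<dots> \<le> card ?U + card ?L + card ?M"
    using card_Un_le[of "?U \<union> ?L" ?M] card_Un_le[of ?U ?L] by linarith
  also have "card ?L = card ?U"
  proof (rule bij_betw_same_card[OF bij_betwI])
    have c: "card ({..<2 * m} - A) = 2 * m - card A" "card A \<le> 2 * m" if "A \<in> ?P" for A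
      using that card_mono[of "{..<2 * m}" A] finite_subset[of A "{..<2 * m}"]
      by (auto simp: card_Diff_subset)
    show "(\<lambda>A. {..<2 * m} - A) \<in> ?L \<rightarrow> ?U"
    proof (rule Pi_I)
      fix A assume "A \<in> ?L"
      then have "2 * m + t \<le> 2 * card ({..<2 * m} - A)" using c(1)[of A] by auto
      then show "{..<2 * m} - A \<in> ?U" by simp
    qed
    show "(\<lambda>A. {..<2 * m} - A) \<in> ?U \<rightarrow> ?L"
    proof (rule Pi_I)
      fix A assume "A \<in> ?U"
      then have "2 * card ({..<2 * m} - A) + t \<le> 2 * m" using c[of A] by auto
      then show "{..<2 * m} - A \<in> ?L" by simp
    qed
  qed auto
  also have "card ?M \<le> t * ((2 * m) choose m)" using card_subsets_card_window[of "2 * m" l t] by simp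
  finally show ?thesis by (simp add: card_Pow)
qed

text \<open>Sets with at least (n + t) / 2 elements in the first \<open>n\<close> points meet there
  in \<open>t\<close> points. Their measure tends to 1/2 because the few middle layers become
  negligible.\<close>

lemma w_inf_half:
  assumes "1 \<le> t"
  shows "w_inf t (1/2) = 1/2"
proof -
  interpret biased_cube "1/2" by unfold_locales auto
  show ?thesis
  proof (rule w_inf_eqI)
    fix e :: real assume e: "e > 0"
    obtain m0 where m0: "\<forall>m\<ge>m0. real ((2 * m) choose m) < (2 * e / t) * 2 ^ (2 * m)"
      using central_binomial_small[of "2 * e / t"] e assms by auto
    define m where "m = max m0 t"
    define n where "n = 2 * m"
    define F where "F = {A. n + t \<le> 2 * card (A \<inter> {..<n})}"
    have "at_least t (A \<inter> B)" if "A \<in> F" "B \<in> F" for A B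
    proof -
      have "card (A \<inter> {..<n}) + card (B \<inter> {..<n})
          = card ((A \<inter> {..<n}) \<union> (B \<inter> {..<n})) + card ((A \<inter> {..<n}) \<inter> (B \<inter> {..<n}))"
        by (intro card_Un_Int) auto
      moreover have "card ((A \<inter> {..<n}) \<union> (B \<inter> {..<n})) \<le> card {..<n}" by (intro card_mono) auto
      ultimately have "at_least t ((A \<inter> {..<n}) \<inter> (B \<inter> {..<n}))"
        using that by (simp add: F_def at_least_def)
      then show ?thesis by (rule at_least_mono) auto
    qed
    then have "t_intersecting t F" by (simp add: t_intersecting_at_least)
    moreover have det: "determined n F"
      unfolding F_def using determined_Collect[of n "\<lambda>A. n + t \<le> 2 * card A"] by simp
    moreover have "1/2 - e < prob F"
    proof -
      have I: "Pow {..<n} \<inter> F = {A \<in> Pow {..<n}. n + t \<le> 2 * card A}"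
        by (auto simp: F_def Int_absorb2)
      have "weight n A = 1 / 2 ^ n" if "A \<in> Pow {..<n}" for A
      proof -
        have "card A \<le> n" using that card_mono[of "{..<n}" A] by simp
        then show ?thesis
          by (simp add: weight_def power_add[symmetric] power_one_over)
      qed
      then have "2 ^ n * prob F = real (card (Pow {..<n} \<inter> F))"
        by (simp add: prob_determined[OF det])
      moreover have "2 ^ n \<le> 2 * real (card (Pow {..<n} \<inter> F)) + t * real ((2 * m) choose m)"
      proof -
        have "2 ^ n \<le> 2 * card (Pow {..<n} \<inter> F) + t * ((2 * m) choose m)"
          unfolding I using card_large_subsets[of t m] by (simp add: n_def m_def)
        then have "real (2 ^ n) \<le> real (2 * card (Pow {..<n} \<inter> F) + t * ((2 * m) choose m))"
          by (simp only: of_nat_le_iff)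
        then show ?thesis by simp
      qed
      moreover have "t * real ((2 * m) choose m) < 2 * e * 2 ^ n"
        using m0[rule_format, of m] assms by (simp add: n_def m_def field_simps)
      ultimately have "2 ^ n * 1 < 2 ^ n * (2 * e + 2 * prob F)" by (simp add: algebra_simps)
      then have "1 < 2 * e + 2 * prob F" by (simp only: mult_less_cancel_left_pos zero_less_power zero_less_numeral)
      then show ?thesis by simp
    qed
    ultimately show "\<exists>F\<in>events. t_intersecting t F \<and> 1/2 - e < prob F"
      using determined_events by blast
  qed (use one_intersecting_prob_le assms in auto)
qed

lemma two_intersecting_measure_neq_half:
  assumes t: "1 < t" and F: "F \<in> sets (mu (1/2))" "t_intersecting t F"
  shows "measure (mu (1/2)) F \<noteq> 1/2"
proof
  assume half: "measure (mu (1/2)) F = 1/2"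
  interpret biased_cube "1/2" by unfold_locales auto
  obtain F' where F': "F' \<subseteq> F" "F' \<in> events" "prob F' = 1/2"
    using mu_core[OF F(1)] half by auto
  have tF: "t_intersecting t F'" using t_intersecting_subset[OF F(2) F'(1)] .
  have "prob (pivotal i F') = 0" for i
  proof -
    \<comment> \<open>The image of \<open>F'\<close> under flipping \<open>i\<close>. As
      \<open>prob F'\<close> is already the maximal value 1/2, it suffices that
      \<open>F' \<union> H\<close> is intersecting to get \<open>H\<close> inside \<open>F'\<close>
      up to a null set.\<close>
    define H where "H = ({A. i \<in> A} \<inter> {A. A - {i} \<in> F'}) \<union> (- {A. i \<in> A} \<inter> {A. insert i A \<in> F'})"
    have H: "H \<in> events" unfolding H_def
      by (intro sets.Un sets.Int sets_cube_member events_complement sets_remove_cube sets_insert_cube F'(2))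
    have near: "\<exists>A'\<in>F'. A' - {i} \<subseteq> A" if "A \<in> F' \<union> H" for A
      using that by (auto simp: H_def)
    have "t_intersecting 1 (F' \<union> H)"
      unfolding t_intersecting_at_least at_least_1
    proof (intro ballI notI)
      fix A B assume "A \<in> F' \<union> H" "B \<in> F' \<union> H" and e: "A \<inter> B = {}"
      then obtain A' B' where AB: "A' \<in> F'" "A' - {i} \<subseteq> A" "B' \<in> F'" "B' - {i} \<subseteq> B"
        using near by meson
      then have "A' \<inter> B' \<subseteq> {i}" using e by auto
      moreover have "at_least t (A' \<inter> B')" using tF AB by (simp add: t_intersecting_at_least)
      ultimately have "at_least t {i}" by (rule at_least_mono[rotated])
      then show False using t by (simp add: at_least_def)
    qed
    then have "prob (F' \<union> H) \<le> 1/2" using F'(2) H by (intro one_intersecting_prob_le) auto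
    moreover have "prob (F' \<union> H) = prob F' + prob (H - F')"
      using F'(2) H by (rule finite_measure_Union')
    ultimately have "prob (H - F') = 0" using F'(3) by (intro antisym measure_nonneg) simp
    moreover define X where "X = H - F'"
    ultimately have X: "X \<in> events" "prob X = 0" using H F'(2) by auto
    \<comment> \<open>If \<open>i\<close> is pivotal at \<open>A\<close>, exactly one of
      \<open>insert i A\<close> and \<open>A - {i}\<close> is in \<open>F'\<close>; the other is its
      flip and so lies in \<open>H - F'\<close>.\<close>
    have "A \<in> {A. insert i A \<in> X} \<union> {A. A - {i} \<in> X}" if "A \<in> pivotal i F'" for A
      using that by (simp add: pivotal_def H_def X_def)
    then have "pivotal i F' \<subseteq> {A. insert i A \<in> X} \<union> {A. A - {i} \<in> X}" by blast
    moreover have "prob ({A. insert i A \<in> X} \<union> {A. A - {i} \<in> X}) = 0"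
      using X by (intro null_Un sets_insert_cube sets_remove_cube null_insert null_remove) auto
    moreover have "{A. insert i A \<in> X} \<union> {A. A - {i} \<in> X} \<in> events"
      using X by (intro sets.Un sets_insert_cube sets_remove_cube)
    ultimately show ?thesis using null_mono by blast
  qed
  \<comment> \<open>Zero coordinates remain, so \<open>D\<close> is empty or everything: a zero-one
    law.\<close>
  then obtain D where D: "determined 0 D" "prob (sym_diff F' D) = 0"
    using pivotal_null_imp_determined[OF F'(2), of 0] by blast
  have "prob F' = prob D"
    using prob_diff_le_sym_diff[OF F'(2) determined_events[OF D(1)]] D(2) by simp
  moreover have "D = {} \<or> D = UNIV" using D(1) by (auto simp: determined_def)
  ultimately show False using F'(3) prob_UNIV by auto
qed

theorem theorem4p3:
  fixes t :: nat and p :: real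
  assumes "t \<ge> 1" and "0 < p" and "p < 1"
  shows
    "(p < 1/2 \<longrightarrow>
        w_inf t p = w t p \<and>
        (\<forall>\<F>. \<F> \<in> sets (mu p) \<and> t_intersecting t \<F> \<and> measure (mu p) \<F> = w_inf t p \<longrightarrow>
           essentially_finitely_determined p \<F>)) \<and>
     (p = 1/2 \<longrightarrow>
        w_inf t p = 1/2 \<and>
        (t > 1 \<longrightarrow>
           \<not> (\<exists>\<F>. \<F> \<in> sets (mu (1/2)) \<and> t_intersecting t \<F> \<and> measure (mu (1/2)) \<F> = 1/2))) \<and>
     (p > 1/2 \<longrightarrow> w_inf t p = 1) \<and>
     (\<exists>\<F> :: nat set set.
        (\<forall>q\<in>{0<..<1}. \<F> \<in> sets (mu q)) \<and>
        (\<forall>A\<in>\<F>. \<forall>B\<in>\<F>. infinite (A \<inter> B)) \<and>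
        (\<forall>q\<in>{1/2<..<1}. measure (mu q) \<F> = 1))"
proof (intro conjI impI allI notI)
  interpret biased_cube p by unfold_locales (use assms in auto)
  show "w_inf t p = w t p" if "p < 1/2" using that by (intro w_inf_eq_w) simp
  show "essentially_finitely_determined p \<F>"
    if "p < 1/2" "\<F> \<in> sets (mu p) \<and> t_intersecting t \<F> \<and> measure (mu p) \<F> = w_inf t p" for \<F>
    using maximal_imp_essentially_finitely_determined that assms by blast
  show "w_inf t p = 1/2" if "p = 1/2" unfolding that by (rule w_inf_half[OF assms(1)])
  show False if "t > 1"
    "\<exists>\<F>. \<F> \<in> sets (mu (1/2)) \<and> t_intersecting t \<F> \<and> measure (mu (1/2)) \<F> = 1/2"
    using two_intersecting_measure_neq_half that by blast
  show "w_inf t p = 1" if "p > 1/2"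
  proof (rule w_inf_eqI)
    fix e :: real assume "e > 0"
    moreover have "t_intersecting t sparse_majority"
      using infinite_Int_sparse_majority by (simp add: t_intersecting_def)
    ultimately show "\<exists>F\<in>events. t_intersecting t F \<and> 1 - e < prob F"
      using sparse_majority_sets prob_sparse_majority that assms(3) by (intro bexI[of _ sparse_majority]) auto
  qed simp
  show "\<exists>\<F> :: nat set set.
        (\<forall>q\<in>{0<..<1}. \<F> \<in> sets (mu q)) \<and>
        (\<forall>A\<in>\<F>. \<forall>B\<in>\<F>. infinite (A \<inter> B)) \<and>
        (\<forall>q\<in>{1/2<..<1}. measure (mu q) \<F> = 1)"
  proof (intro exI[of _ sparse_majority] conjI ballI)
    fix q :: real assume q: "q \<in> {1/2<..<1}"
    interpret q: biased_cube q by unfold_locales (use q in auto)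
    show "measure (mu q) sparse_majority = 1"
      using q.prob_sparse_majority q by (simp add: measure_mu sparse_majority_sets)
  qed (use sets_mu sparse_majority_sets infinite_Int_sparse_majority in auto)
qed

end
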